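(* Let $d\ge3$ and $1\le n<d$. Put $w_{n,d}=\frac{n}{d-n}$ and let $\mathfrak{W}_{n,d}$ be the unique root in the interval $(0,w_{n,d})$ of the equation $$x^{d-n+1}-w_{n,d}^{\,d-n-1}(1+w_{n,d})\,x+w_{n,d}^{\,d-n}=0.$$ Suppose $\mathcal{L}$ is an $n$-dimensional badly approximable completely irrational linear subspace of $\mathbb{R}^d$. Then for every $\xi\in\mathcal{L}$ of the form $\xi=(\xi_1,\dots,\xi_{d-1},1)$ one has $\hat{\omega}(\xi)\le\mathfrak{W}_{n,d}$.
   Context: A linear subspace of $\mathbb{R}^d$ is rational if it has a basis of integer vectors; an $n$-dimensional subspace $\mathcal{L}\subset\mathbb{R}^d$, $n<d$, is completely irrational if $\mathcal{L}\cap\mathcal{M}=\{0\}$ for every rational subspace $\mathcal{M}$ of dimension $d-n$. A real $m\times n$ matrix $\Theta=(\theta_j^i)$ is badly approximable if, with $L_j(x)=\sum_i\theta_j^ix_i$, there is $c>0$ with $(\max_i|x_i|)^n(\max_j\|L_j(x)\|)^m>c$ for all $x\in\mathbb{Z}^n\setminus\{0\}$, where $\|\cdot\|$ is distance to the nearest integer. An $n$-dimensional subspace $\mathcal{L}\subset\mathbb{R}^d$ is badly approximable if the standard coordinates of $\mathbb{R}^d$ can be split (after reordering) as $x_1,\dots,x_n;y_1,\dots,y_m$, $m=d-n$, so that $\mathcal{L}=\{y=\Theta x\}$ for some badly approximable $m\times n$ matrix $\Theta$. For $\xi=(\xi_1,\dots,\xi_{d-1},1)$, the uniform exponent $\hat{\omega}(\xi)$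 is the supremum of $\gamma>0$ such that for all sufficiently large $t$ the system $\max_{1\le j\le d-1}\|q\xi_j\|\le t^{-\gamma}$, $0<q\le t$, has a solution $q\in\mathbb{Z}$.
   Formalization: For n=1 the equation has no root in (0,w_{1,d}) (w_{1,d} is a double root), so 𝔚_{1,d} is undefined as stated; here 𝔚_{1,d} is taken to be w_{1,d}=1/(d-1). For n≥2 it is the unique root in the open interval, as stated. *)

theory Defs
  imports "HOL-Analysis.Analysis"
begin

definition rational_subspace :: "(real ^ 'd) set \<Rightarrow> bool" where
  "rational_subspace M \<longleftrightarrow>
     (\<exists>B. independent B \<and> span B = M \<and> (\<forall>b\<in>B. \<forall>i. b $ i \<in> \<int>))"

definition completely_irrational :: "(real ^ 'd) set \<Rightarrow> bool" where
  "completely_irrational L \<longleftrightarrow>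
     subspace L \<and> dim L < CARD('d) \<and>
     (\<forall>M. rational_subspace M \<and> dim M = CARD('d) - dim L \<longrightarrow> L \<inter> M = {0})"

definition dist_int :: "real \<Rightarrow> real" where
  "dist_int x = \<bar>x - of_int (round x)\<bar>"

text \<open>
  Matrices with rows indexed by the finite set \<open>J\<close> and columns indexed by the finite
  set \<open>I\<close>; a vector of \<open>\<int>\<^sup>I\<close> is a function of which only the values on \<open>I\<close> matter.
\<close>

definition badly_approximable_matrix ::
  "'j set \<Rightarrow> 'i set \<Rightarrow> ('j \<Rightarrow> 'i \<Rightarrow> real) \<Rightarrow> bool" where
  "badly_approximable_matrix J I \<Theta> \<longleftrightarrow>
     (\<exists>c>0. \<forall>x :: 'i \<Rightarrow> int. (\<exists>i\<in>I. x i \<noteq> 0) \<longrightarrow>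
        (MAX i\<in>I. \<bar>real_of_int (x i)\<bar>) ^ card I *
        (MAX j\<in>J. dist_int (\<Sum>i\<in>I. \<Theta> j i * real_of_int (x i))) ^ card J > c)"

text \<open>
  The splitting of the coordinates into \<open>x\<^sub>1, \<dots>, x\<^sub>n; y\<^sub>1, \<dots>, y\<^sub>m\<close> is given by the set \<open>I\<close> of
  the indices of the \<open>x\<close>-coordinates and its complement.
\<close>

definition badly_approximable_subspace :: "(real ^ 'd) set \<Rightarrow> bool" where
  "badly_approximable_subspace L \<longleftrightarrow>
     (\<exists>I \<Theta>. card I = dim L \<and> badly_approximable_matrix (- I) I \<Theta> \<and>
        L = {v. \<forall>j\<in>- I. v $ j = (\<Sum>i\<in>I. \<Theta> j i * v $ i)})"

text \<open>
  The index \<open>k\<close> marks the coordinate of \<open>\<xi>\<close> that is normalised to \<open>1\<close>. The supremum is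
  taken in the extended reals, since it is infinite for rational \<open>\<xi>\<close>.
\<close>

definition uniform_exponent :: "'d \<Rightarrow> real ^ 'd \<Rightarrow> ereal" where
  "uniform_exponent k \<xi> =
     Sup (ereal ` {\<gamma>. \<gamma> > 0 \<and>
       (\<forall>\<^sub>F t :: real in at_top. \<exists>q :: int. 0 < q \<and> real_of_int q \<le> t \<and>
          (MAX j\<in>- {k}. dist_int (real_of_int q * \<xi> $ j)) \<le> t powr (- \<gamma>))})"

definition w_exp :: "nat \<Rightarrow> nat \<Rightarrow> real" where
  "w_exp n d = real n / real (d - n)"

definition W_poly :: "nat \<Rightarrow> nat \<Rightarrow> real \<Rightarrow> real" where
  "W_poly n d x =
     x ^ (d - n + 1) - w_exp n d ^ (d - n - 1) * (1 + w_exp n d) * x + w_exp n d ^ (d - n)"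

text \<open>
  The point \<open>w_exp n d\<close> is itself a zero of \<open>W_poly n d\<close>. For \<open>n \<ge> 2\<close> there is exactly one
  further zero in \<open>(0, w_exp n d)\<close>, see \<open>W_poly_unique_root\<close> below. For \<open>n = 1\<close> the two zeros
  merge into a double zero at \<open>w_exp 1 d\<close> and the open interval contains none, see
  \<open>W_poly_no_root\<close>; the value is then this double zero.
\<close>

definition W_exp :: "nat \<Rightarrow> nat \<Rightarrow> real" where
  "W_exp n d =
     (if n = 1 then w_exp n d
      else (THE x. x \<in> {0<..<w_exp n d} \<and> W_poly n d x = 0))"

lemma W_poly_w_exp:
  assumes "n < d"
  shows "W_poly n d (w_exp n d) = 0"
proof -
  obtain m where "d - n = Suc m" using assms by (metis Suc_diff_Suc)
  then show ?thesis by (simp add: W_poly_def algebra_simps)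
qed

definition W_deriv :: "nat \<Rightarrow> nat \<Rightarrow> real \<Rightarrow> real" where
  "W_deriv n d x = real (d - n + 1) * x ^ (d - n) - w_exp n d ^ (d - n - 1) * (1 + w_exp n d)"

lemma W_poly_deriv: "(W_poly n d has_real_derivative W_deriv n d x) (at x)"
  unfolding W_poly_def[abs_def] W_deriv_def
  by (rule derivative_eq_intros refl | simp)+

lemma W_deriv_strict_mono:
  assumes "n < d" "0 \<le> x" "x < y"
  shows "W_deriv n d x < W_deriv n d y"
  using assms by (simp add: W_deriv_def power_strict_mono)

lemma W_deriv_w_exp:
  assumes "n < d"
  shows "W_deriv n d (w_exp n d) = w_exp n d ^ (d - n - 1) * (real n - 1)"
proof -
  obtain m where m: "d - n = Suc m" using assms by (metis Suc_diff_Suc)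
  have "w_exp n d * real (Suc m) = real n" by (simp add: w_exp_def m)
  then have n: "real n = w_exp n d * (1 + real m)" by simp
  show ?thesis by (simp add: W_deriv_def m n algebra_simps)
qed

lemma W_poly_Rolle:
  assumes "x < y" "W_poly n d x = 0" "W_poly n d y = 0"
  obtains z where "x < z" "z < y" "W_deriv n d z = 0"
proof -
  obtain z where "x < z" "z < y" "W_poly n d y - W_poly n d x = (y - x) * W_deriv n d z"
    using MVT2[of x y "W_poly n d" "W_deriv n d"] W_poly_deriv assms(1) by blast
  then show ?thesis using that assms by simp
qed

lemma W_poly_unique_root:
  assumes "2 \<le> n" "n < d"
  shows "\<exists>!x. x \<in> {0<..<w_exp n d} \<and> W_poly n d x = 0"
proof (rule ex_ex1I)
  have w: "w_exp n d > 0" using assms by (simp add: w_exp_def)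
  have "W_deriv n d (w_exp n d) > 0" using assms w by (simp add: W_deriv_w_exp)
  from DERIV_pos_inc_left[OF W_poly_deriv this]
  obtain e where e: "e > 0" "\<And>h. 0 < h \<Longrightarrow> h < e \<Longrightarrow> W_poly n d (w_exp n d - h) < 0"
    using W_poly_w_exp[OF assms(2)] by metis
  define h where "h = min e (w_exp n d) / 2"
  have h: "0 < h" "h < e" "h < w_exp n d" using e(1) w by (auto simp: h_def min_def)
  have c: "continuous_on A (W_poly n d)" for A
    by (meson DERIV_isCont W_poly_deriv continuous_at_imp_continuous_on)
  have 0: "W_poly n d 0 > 0" using w by (simp add: W_poly_def)
  obtain x where x: "0 \<le> x" "x \<le> w_exp n d - h" "W_poly n d x = 0"
    using IVT2'[of "W_poly n d" "w_exp n d - h" 0 0] e(2)[OF h(1,2)] 0 h c by auto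
  moreover have "x \<noteq> 0" using 0 x(3) by auto
  ultimately show "\<exists>x. x \<in> {0<..<w_exp n d} \<and> W_poly n d x = 0"
    using h by (intro exI[of _ x]) auto
next
  have no: False if xy: "0 < x" "x < y" "y < w_exp n d" "W_poly n d x = 0" "W_poly n d y = 0" for x y
  proof -
    obtain z where z: "x < z" "z < y" "W_deriv n d z = 0"
      using W_poly_Rolle[OF xy(2,4,5)] by blast
    obtain z' where z': "y < z'" "W_deriv n d z' = 0"
      using W_poly_Rolle[OF xy(3,5) W_poly_w_exp[OF assms(2)]] by blast
    show False using W_deriv_strict_mono[OF assms(2), of z z'] z z' xy by simp
  qed
  fix x y
  assume "x \<in> {0<..<w_exp n d} \<and> W_poly n d x = 0" "y \<in> {0<..<w_exp n d} \<and> W_poly n d y = 0"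
  then show "x = y" using no[of x y] no[of y x] by (cases x y rule: linorder_cases) auto
qed

lemma W_poly_no_root:
  assumes "1 < d"
  shows "\<not> (\<exists>x. x \<in> {0<..<w_exp 1 d} \<and> W_poly 1 d x = 0)"
proof
  assume "\<exists>x. x \<in> {0<..<w_exp 1 d} \<and> W_poly 1 d x = 0"
  then obtain x where x: "0 < x" "x < w_exp 1 d" "W_poly 1 d x = 0" by auto
  obtain z where "x < z" "z < w_exp 1 d" "W_deriv 1 d z = 0"
    using W_poly_Rolle[OF x(2,3) W_poly_w_exp[OF assms]] by blast
  then show False
    using W_deriv_strict_mono[OF assms, of z "w_exp 1 d"] W_deriv_w_exp[OF assms] x by simp
qed

end

theory Submission
  imports Defs
begin

text \<open>
  Let \<open>m = d - n\<close>, \<open>w = n / m\<close>, and let \<open>x\<^sub>i\<close> be the integer vectors nearest to \<open>X\<^sub>i \<xi>\<close>, where the \<open>X\<^sub>i\<close>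
  are the record denominators of \<open>\<xi>\<close> with errors \<open>L\<^sub>i\<close>. If \<open>\<alpha>\<close> is below the uniform exponent, then
  \<open>L\<^sub>i \<le> X\<^sub>i\<^sub>+\<^sub>1\<^sup>-\<^sup>\<alpha>\<close> up to constants, while bad approximability of the subspace gives
  \<open>L\<^sub>i \<ge> X\<^sub>i\<^sup>-\<^sup>w\<close>, so \<open>X\<^sub>i\<^sub>+\<^sub>1 \<le> X\<^sub>i\<^sup>\<theta>\<close> with \<open>\<theta> = w / \<alpha>\<close>. Complete irrationality forces every tail of the
  \<open>x\<^sub>i\<close> to span a space of dimension at least \<open>m + 1\<close>.

  Put \<open>b\<^sub>j = 1 - \<alpha> (1 + \<theta>\<^sup>-\<^sup>1 + \<dots> + \<theta>\<^sup>-\<^sup>(\<^sup>j\<^sup>-\<^sup>1\<^sup>))\<close>. By induction on \<open>j\<close>, whenever \<open>x\<^sub>f, \<dots>, x\<^sub>l\<close> span a space of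
  dimension \<open>j + 1\<close>, this space has independent integer vectors whose parallelepiped has volume at
  most \<open>X\<^sub>f\<close> to the power \<open>\<theta>\<^sup>j b\<^sub>j\<close> and at most \<open>X\<^sub>l\<close> to the power \<open>b\<^sub>j\<close>. Such volumes are at least 1, so
  \<open>b\<^sub>m \<ge> 0\<close>, that is \<open>\<alpha> (1 + \<alpha> / w + \<dots> + (\<alpha> / w)\<^sup>m\<^sup>-\<^sup>1) \<le> 1\<close>. Up to the factor \<open>x - w\<close>, equality here is
  the equation defining the bound.
\<close>

section \<open>Volumes of integer bases\<close>

text \<open>The volume of the parallelepiped spanned by the list, that is, the square root of its
  Gram determinant. In this recursive form, adjoining a vector contributes a single distance to a
  subspace.\<close>

fun gvol :: "(real ^ 'd) list \<Rightarrow> real" where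
  "gvol [] = 1"
| "gvol (x # xs) = infdist x (span (set xs)) * gvol xs"

lemma infdist_span_eq_norm:
  fixes y z :: "'a :: euclidean_space"
  assumes "y \<in> span S" and "\<And>w. w \<in> span S \<Longrightarrow> orthogonal z w"
  shows "infdist (y + z) (span S) = norm z"
proof (rule antisym)
  show "infdist (y + z) (span S) \<le> norm z"
    using infdist_le[OF assms(1), of "y + z"] by (simp add: dist_norm)
  have "norm z \<le> dist (y + z) w" if w: "w \<in> span S" for w
  proof -
    have "orthogonal z (y - w)" using assms w by (simp add: span_diff)
    then have "(norm (z + (y - w)))\<^sup>2 = (norm z)\<^sup>2 + (norm (y - w))\<^sup>2"
      by (rule norm_add_Pythagorean)
    then have "(norm z)\<^sup>2 \<le> (norm (z + (y - w)))\<^sup>2" by simp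
    then show ?thesis by (simp add: dist_norm add.commute add_diff_eq)
  qed
  then show "norm z \<le> infdist (y + z) (span S)"
    by (auto simp: infdist_def intro!: cINF_greatest) (use span_0 in blast)
qed

lemma gvol_nonneg: "gvol xs \<ge> 0"
  by (induction xs) (auto simp: infdist_nonneg)

lemma gvol_eq_prod:
  "gvol xs = (\<Prod>p<length xs. infdist (xs ! p) (span (set (drop (Suc p) xs))))"
  by (induction xs) (auto simp: prod.lessThan_Suc_shift simp del: prod.lessThan_Suc)

lemma det_Ints:
  fixes A :: "real ^ 'n ^ 'n"
  assumes "\<And>i j. A $ i $ j \<in> \<int>"
  shows "det A \<in> \<int>"
  unfolding det_def using assms by (auto intro!: Ints_sum Ints_mult Ints_prod)

lemma det_orthogonal_rows:
  fixes A :: "real ^ 'n ^ 'n"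
  assumes "\<And>i j. i \<noteq> j \<Longrightarrow> orthogonal (A $ i) (A $ j)"
  shows "\<bar>det A\<bar> = (\<Prod>i\<in>UNIV. norm (A $ i))"
proof -
  have e: "(A ** transpose A) $ i $ j = A $ i \<bullet> A $ j" for i j
    by (simp add: matrix_matrix_mult_def transpose_def inner_vec_def)
  have "(det A)\<^sup>2 = det (A ** transpose A)" by (simp add: det_mul power2_eq_square)
  also have "\<dots> = (\<Prod>i\<in>UNIV. A $ i \<bullet> A $ i)"
    using assms by (subst det_diagonal) (auto simp: e orthogonal_def)
  also have "\<dots> = (\<Prod>i\<in>UNIV. norm (A $ i))\<^sup>2"
    by (simp add: prod_power_distrib power2_norm_eq_inner)
  finally show ?thesis
    by (metis abs_of_nonneg norm_ge_zero prod_nonneg real_sqrt_abs)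
qed

text \<open>Gram-Schmidt: each row is replaced by its component orthogonal to the later rows. This
  subtracts a combination of other rows, so the determinant stays the same, and the final rows are
  orthogonal with the factors of \<open>gvol\<close> as their lengths.\<close>

lemma abs_det_eq_gvol:
  fixes xs :: "(real ^ 'd) list" and h :: "'d \<Rightarrow> nat"
  assumes len: "length xs = CARD('d)" and h: "bij_betw h UNIV {..<CARD('d)}"
  shows "\<bar>det (\<chi> i. xs ! h i)\<bar> = gvol xs"
proof -
  let ?T = "\<lambda>p. span (set (drop (Suc p) xs))"
  have "\<exists>y z. y \<in> ?T p \<and> (\<forall>w\<in>?T p. orthogonal z w) \<and> xs ! p = y + z" for p
    using orthogonal_subspace_decomp_exists[of "set (drop (Suc p) xs)" "xs ! p"] by metis
  then obtain y z where y: "\<And>p. y p \<in> ?T p" and z: "\<And>p w. w \<in> ?T p \<Longrightarrow> orthogonal (z p) w"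
    and yz: "\<And>p. xs ! p = y p + z p" by metis
  define B :: "nat \<Rightarrow> real ^ 'd ^ 'd" where
    "B j = (\<chi> i. if h i < j then z (h i) else xs ! h i)" for j
  have hl: "h i < CARD('d)" for i using h by (auto simp: bij_betw_def)
  have hinj: "h i = h j \<longleftrightarrow> i = j" for i j
    using h by (auto simp: bij_betw_def inj_on_def)
  have surj: "\<exists>i. h i = p" if "p < CARD('d)" for p
  proof -
    have "p \<in> range h" using h that by (simp add: bij_betw_def)
    then show ?thesis by auto
  qed
  have row: "row i (B j) = (if h i < j then z (h i) else xs ! h i)" for i j
    by (simp add: row_def B_def vec_eq_iff)
  have step: "det (B (Suc j)) = det (B j)" if j: "j < CARD('d)" for j
  proof -
    obtain i where i: "h i = j" using surj[OF j] by blast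
    \<comment> \<open>Rows are treated in order, so the rows after \<open>j\<close> are still the
      original vectors.\<close>
    have "set (drop (Suc j) xs) \<subseteq> {row i' (B j) |i'. i' \<noteq> i}"
    proof
      fix v assume "v \<in> set (drop (Suc j) xs)"
      then obtain p where p: "p < length xs - Suc j" "v = xs ! (Suc j + p)"
        by (auto simp: in_set_conv_nth)
      then obtain i' where i': "h i' = Suc j + p" using surj[of "Suc j + p"] len by force
      then show "v \<in> {row i' (B j) |i'. i' \<noteq> i}" using p i by (auto simp: row intro!: exI[of _ i'])
    qed
    then have "- y j \<in> vec.span {row i' (B j) |i'. i' \<noteq> i}"
      unfolding span_vec_eq using y[of j] span_mono span_neg by blast
    from det_row_span[OF this]
    have "det (\<chi> k. if k = i then row i (B j) + - y j else row k (B j)) = det (B j)" .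
    moreover have "(\<chi> k. if k = i then row i (B j) + - y j else row k (B j)) = B (Suc j)"
      unfolding row using i hinj by (auto simp: B_def vec_eq_iff yz less_Suc_eq)
    ultimately show ?thesis by simp
  qed
  have "j \<le> CARD('d) \<Longrightarrow> det (B j) = det (B 0)" for j
    by (induction j) (auto simp: step)
  then have det_eq: "det (B CARD('d)) = det (\<chi> i. xs ! h i)" by (simp add: B_def)
  have BC: "B CARD('d) $ i = z (h i)" for i by (simp add: B_def hl)
  \<comment> \<open>Both \<open>xs ! q\<close> and \<open>y q\<close> lie in the span of the entries
    after \<open>p\<close>, hence so does \<open>z q\<close>.\<close>
  have orth: "orthogonal (z p) (z q)" if "p < q" "q < length xs" for p q
  proof -
    have "?T q \<subseteq> ?T p" using that by (intro span_mono set_drop_subset_set_drop) simp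
    moreover have "xs ! q \<in> ?T p" using that
      by (intro span_base) (auto simp: in_set_conv_nth intro!: exI[of _ "q - Suc p"])
    ultimately have "z q \<in> ?T p" using y[of q] span_diff[of "xs ! q" _ "y q"] yz[of q]
      by (metis add_diff_cancel_left' subsetD)
    then show ?thesis by (rule z)
  qed
  have "orthogonal (z (h i)) (z (h j))" if "i \<noteq> j" for i j
    using orth[of "h i" "h j"] orth[of "h j" "h i"] hl len hinj that
    by (metis linorder_neqE_nat orthogonal_commute)
  then have "\<bar>det (B CARD('d))\<bar> = (\<Prod>i\<in>UNIV. norm (z (h i)))"
    by (subst det_orthogonal_rows) (auto simp: BC)
  also have "\<dots> = (\<Prod>p<CARD('d). norm (z p))"
    using prod.reindex_bij_betw[OF h, of "\<lambda>p. norm (z p)"] .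
  also have "\<dots> = gvol xs"
    unfolding gvol_eq_prod len using infdist_span_eq_norm[OF y z] by (simp add: yz)
  finally show ?thesis by (simp add: det_eq)
qed

text \<open>A basis of the vector space \<open>U\<close>, not of the lattice of its integer points:
  independence and integrality are enough for the volume to be at least 1.\<close>

definition int_basis :: "(real ^ 'd) list \<Rightarrow> (real ^ 'd) set \<Rightarrow> bool" where
  "int_basis xs U \<longleftrightarrow> distinct xs \<and> independent (set xs) \<and> span (set xs) = U \<and>
     (\<forall>v\<in>set xs. \<forall>i. v $ i \<in> \<int>)"

lemma int_basis_Cons:
  assumes "int_basis xs (span S)" "x \<notin> span S" "\<And>i. x $ i \<in> \<int>"
  shows "int_basis (x # xs) (span (insert x S))"
proof -
  have "span (insert x (set xs)) = span (insert x S)"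
    using assms(1) by (simp add: int_basis_def span_insert[of x])
  moreover have "x \<notin> set xs" using assms span_base unfolding int_basis_def by metis
  ultimately show ?thesis
    using assms by (auto simp: int_basis_def independent_insert)
qed

lemma gvol_pos: "int_basis xs U \<Longrightarrow> gvol xs > 0"
proof (induction xs arbitrary: U)
  case (Cons x xs)
  then have "int_basis xs (span (set xs))" "x \<notin> span (set xs)"
    by (auto simp: int_basis_def independent_insert)
  moreover from this have "infdist x (span (set xs)) > 0"
    by (intro infdist_pos_not_in_closed closed_subspace subspace_span) (use span_0 in auto)
  ultimately show ?case using Cons.IH by simp
qed simp

text \<open>
  Unit vectors are adjoined until the list is a basis of the whole space; this does not increase
  the volume, which in the end is the absolute value of a nonzero integer determinant.
\<close>

lemma gvol_ge_1:
  fixes xs :: "(real ^ 'd) list"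
  assumes "int_basis xs U"
  shows "gvol xs \<ge> 1"
  using assms
proof (induction "CARD('d) - length xs" arbitrary: xs U)
  case 0
  have "length xs = card (set xs)" using 0 by (simp add: int_basis_def distinct_card)
  also have "\<dots> \<le> CARD('d)"
    using 0 independent_bound_general[of "set xs"] dim_subset_UNIV_cart[of "set xs"]
    by (auto simp: int_basis_def)
  finally have len: "length xs = CARD('d)" using 0 by simp
  obtain h :: "'d \<Rightarrow> nat" where h: "bij_betw h UNIV {..<CARD('d)}"
    using ex_bij_betw_finite_nat[of "UNIV :: 'd set"] by (auto simp: atLeast0LessThan)
  have "h i < length xs" for i using h len by (auto simp: bij_betw_def)
  then have "det (\<chi> i. xs ! h i) \<in> \<int>"
    using 0 by (intro det_Ints) (auto simp: int_basis_def)
  moreover have "\<bar>det (\<chi> i. xs ! h i)\<bar> = gvol xs" by (rule abs_det_eq_gvol[OF len h])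
  ultimately show ?case using gvol_pos[OF 0(2)]
    by (metis Ints_nonzero_abs_ge1 abs_0 less_irrefl)
next
  case (Suc k)
  have "dim (set xs) = length xs"
    using Suc.prems by (simp add: int_basis_def dim_eq_card_independent distinct_card)
  then have "dim (span (set xs)) = length xs" by simp
  then have "span (set xs) \<noteq> UNIV" using Suc.hyps(2)
    by (metis DIM_cart DIM_real dim_UNIV diff_self_eq_0 mult.right_neutral nat.distinct(1))
  moreover have "span (set xs) = UNIV" if "range (\<lambda>i. axis i (1::real)) \<subseteq> span (set xs)"
  proof -
    have "Basis \<subseteq> span (set xs)" using that by (auto simp: Basis_vec_def)
    then show ?thesis by (metis span_Basis span_mono span_span top.extremum_uniqueI)
  qed
  ultimately obtain i where i: "axis i 1 \<notin> span (set xs)" by blast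
  let ?xs = "axis i 1 # xs"
  have "int_basis xs (span (set xs))" using Suc.prems by (simp add: int_basis_def)
  then have ib: "int_basis ?xs (span (insert (axis i 1) (set xs)))"
    using i by (intro int_basis_Cons) (auto simp: axis_def)
  have "1 \<le> gvol ?xs" using Suc.hyps(2) by (intro Suc.hyps(1)[OF _ ib]) auto
  also have "infdist (axis i 1) (span (set xs)) \<le> 1"
    using infdist_le[OF span_0, of "axis i 1" "set xs"] by simp
  then have "gvol ?xs \<le> gvol xs"
    using gvol_nonneg[of xs] by (simp add: mult_left_le_one_le infdist_nonneg)
  finally show ?case .
qed

text \<open>The new factor of the volume is the distance from \<open>x\<close> to
  \<open>span S\<close>, which is at most the distance to the point
  \<open>r *\<^sub>R y\<close>.\<close>

lemma int_basis_extend: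
  assumes "int_basis xs (span S)" "x \<notin> span S" "\<And>i. x $ i \<in> \<int>"
    and "y \<in> span S" "norm (x - r *\<^sub>R y) \<le> exp e"
  shows "int_basis (x # xs) (span (insert x S)) \<and> ln (gvol (x # xs)) \<le> ln (gvol xs) + e"
proof
  show ib: "int_basis (x # xs) (span (insert x S))" by (rule int_basis_Cons[OF assms(1-3)])
  have "infdist x (span (set xs)) \<le> exp e"
    using assms infdist_le[of "r *\<^sub>R y" "span S" x]
    by (auto simp: int_basis_def span_scale dist_norm intro: order_trans)
  then have "gvol (x # xs) \<le> exp e * gvol xs" by (simp add: gvol_nonneg mult_right_mono)
  then have "ln (gvol (x # xs)) \<le> ln (exp e * gvol xs)"
    using gvol_pos[OF ib] by (intro ln_mono) auto
  also have "\<dots> = ln (gvol xs) + e" using gvol_pos[OF assms(1)] by (simp add: ln_mult)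
  finally show "ln (gvol (x # xs)) \<le> ln (gvol xs) + e" .
qed

section \<open>Chains of approximations\<close>

text \<open>A discrete intermediate value theorem: upward steps of size at most one cannot jump past
  a value.\<close>

lemma nat_step_crossing:
  fixes f :: "nat \<Rightarrow> nat"
  assumes "\<And>i. f (Suc i) \<le> Suc (f i)" and "f a \<le> k" and "k < f b" and "a \<le> b"
  obtains i where "a \<le> i" "i < b" "f i = k" "f (Suc i) = Suc k"
proof -
  have "\<exists>i. a \<le> i \<and> i < b \<and> f i = k \<and> f (Suc i) = Suc k"
    using \<open>a \<le> b\<close> \<open>k < f b\<close>
  proof (induction b rule: dec_induct)
    case base then show ?case using assms(2) by simp
  next
    case (step b)
    show ?case
    proof (cases "k < f b")
      case True then show ?thesis using step.IH by (meson less_Suc_eq)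
    next
      case False
      then show ?thesis using step assms(1)[of b] by (intro exI[of _ b]) auto
    qed
  qed
  then show ?thesis using that by blast
qed

text \<open>
  The number \<open>h i\<close> is the logarithm of the height \<open>X\<^sub>i\<close> of \<open>x i\<close>. The forward and backward
  conditions bound the distance of a point to the line through its neighbour; they come from an
  approximation error \<open>L\<^sub>i \<le> X\<^sub>i\<^sub>+\<^sub>1\<^sup>-\<^sup>\<alpha>\<close>.
\<close>

locale approximation_chain =
  fixes x :: "nat \<Rightarrow> real ^ 'd" and h :: "nat \<Rightarrow> real" and \<alpha> \<theta> c :: real and m :: nat
  assumes x_Ints: "x i $ j \<in> \<int>"
    and x_nonzero: "x i \<noteq> 0"
    and norm_x: "norm (x i) \<le> exp (h i + c)"
    and forward: "\<exists>r. norm (x (Suc i) - r *\<^sub>R x i) \<le> exp ((1 - \<alpha>) * h (Suc i) - h i + c)"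
    and backward: "\<exists>r. norm (x i - r *\<^sub>R x (Suc i)) \<le> exp (- \<alpha> * h (Suc i) + c)"
    and growth: "h (Suc i) \<le> \<theta> * h i + c"
    and mono_h: "mono h"
    and h_at_top: "filterlim h at_top sequentially"
    and tail_dim: "m < dim (x ` {N..})"
    and \<alpha>_pos: "0 < \<alpha>" and \<theta>_gt_1: "1 < \<theta>"
begin

text \<open>These are the exponents \<open>b\<^sub>j\<close> belonging to the right end of an
  interval; multiplied by \<open>\<theta> ^ j\<close> they become the exponents for the left
  end.\<close>

definition slope :: "nat \<Rightarrow> real" where
  "slope j = 1 - \<alpha> * (\<Sum>i<j. 1 / \<theta> ^ i)"

lemma slope_0 [simp]: "slope 0 = 1"
  by (simp add: slope_def)

lemma slope_Suc: "slope (Suc j) = slope j - \<alpha> / \<theta> ^ j"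
  by (simp add: slope_def algebra_simps)

lemma slope_antimono: "i \<le> j \<Longrightarrow> slope j \<le> slope i"
proof (induction j rule: dec_induct)
  case (step j)
  have "\<alpha> / \<theta> ^ j \<ge> 0" using \<alpha>_pos \<theta>_gt_1 by simp
  then show ?case using step by (simp add: slope_Suc)
qed simp

text \<open>Ties the forward recursion for \<open>\<theta> ^ j * slope j\<close> to the backward recursion for \<open>slope j\<close>.\<close>

lemma slope_defect: "\<theta> ^ j * ((\<theta> - 1) * slope j + (1 - \<theta> * (1 - \<alpha>))) = \<alpha> * \<theta>"
proof (induction j)
  case (Suc j)
  have "\<theta> ^ Suc j * ((\<theta> - 1) * slope (Suc j) + (1 - \<theta> * (1 - \<alpha>)))
      = \<theta> * (\<theta> ^ j * ((\<theta> - 1) * slope j + (1 - \<theta> * (1 - \<alpha>)))) - \<theta> * (\<theta> - 1) * \<alpha>"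
    using \<theta>_gt_1 by (simp add: slope_Suc field_simps)
  then show ?case unfolding Suc.IH by (simp add: algebra_simps)
qed (simp add: algebra_simps)

text \<open>Extending the interval to the right raises the dimension by at most one at a time, so
  the step from \<open>j + 1\<close> to \<open>j + 2\<close> occurs. After it the dimension is that
  of the whole interval, hence the spans agree.\<close>

lemma dim_interval_split_last:
  assumes "dim (x ` {f..l}) = Suc (Suc j)"
  obtains p where "f \<le> p" "dim (x ` {f..p}) = Suc j" "x (Suc p) \<notin> span (x ` {f..p})"
    "span (insert (x (Suc p)) (x ` {f..p})) = span (x ` {f..l})"
proof -
  have fl: "f \<le> l" using assms by (cases "f \<le> l") auto
  have ins: "x ` {f..Suc i} = insert (x (Suc i)) (x ` {f..i})" if "f \<le> i" for i
    using that by (simp add: atLeastAtMostSuc_conv)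
  let ?F = "\<lambda>i. dim (x ` {f..i})"
  have "?F (Suc i) \<le> Suc (?F i)" for i
  proof (cases "f \<le> i")
    case True then show ?thesis by (simp add: ins dim_insert)
  next
    case False
    \<comment> \<open>Left of \<open>f\<close> the larger interval has at most one point.\<close>
    then have "{f..Suc i} \<subseteq> {Suc i}" by auto
    then have "?F (Suc i) \<le> dim {x (Suc i)}" by (intro dim_subset) auto
    also have "\<dots> \<le> 1" by simp
    finally show ?thesis by simp
  qed
  moreover have "?F f \<le> Suc j" by simp
  ultimately obtain p where p: "f \<le> p" "p < l" "?F p = Suc j" "?F (Suc p) = Suc (Suc j)"
    using nat_step_crossing[of ?F f "Suc j" l] assms fl by auto
  have "x (Suc p) \<notin> span (x ` {f..p})"
    using p by (auto simp: ins dim_insert)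
  moreover have "span (x ` {f..Suc p}) = span (x ` {f..l})"
    using p assms by (intro subspace_dim_equal span_mono image_mono) auto
  ultimately show ?thesis using p by (intro that[of p]) (auto simp: ins)
qed

lemma dim_interval_split_first:
  assumes "dim (x ` {f..l}) = Suc (Suc j)"
  obtains p where "f \<le> p" "p < l" "dim (x ` {Suc p..l}) = Suc j" "x p \<notin> span (x ` {Suc p..l})"
    "span (insert (x p) (x ` {Suc p..l})) = span (x ` {f..l})"
proof -
  have fl: "f \<le> l" using assms by (cases "f \<le> l") auto
  have ins: "x ` {i..l} = insert (x i) (x ` {Suc i..l})" if "i \<le> l" for i
    using that by (simp add: Icc_eq_insert_lb_nat)
  \<comment> \<open>Here the interval grows to the left, so it is indexed by the distance from
    \<open>l\<close>; truncated subtraction makes \<open>?F\<close> constant from \<open>l\<close>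
    on.\<close>
  let ?F = "\<lambda>i. dim (x ` {l - i..l})"
  have "?F (Suc i) \<le> Suc (?F i)" for i
  proof (cases "i < l")
    case True
    then show ?thesis using ins[of "l - Suc i"] by (simp add: dim_insert Suc_diff_Suc)
  qed simp
  moreover have "?F 0 \<le> Suc j" by simp
  ultimately obtain q where q: "q < l - f" "?F q = Suc j" "?F (Suc q) = Suc (Suc j)"
    using nat_step_crossing[of ?F 0 "Suc j" "l - f"] assms fl by auto
  define p where "p = l - Suc q"
  have p: "f \<le> p" "p < l" "dim (x ` {Suc p..l}) = Suc j" "dim (x ` {p..l}) = Suc (Suc j)"
    using q by (auto simp: p_def Suc_diff_Suc)
  have "x p \<notin> span (x ` {Suc p..l})"
    using p by (auto simp: ins dim_insert)
  moreover have "span (x ` {p..l}) = span (x ` {f..l})"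
    using p assms by (intro subspace_dim_equal span_mono image_mono) auto
  ultimately show ?thesis using p by (intro that[of p]) (auto simp: ins)
qed

text \<open>A basis of the tail uses finitely many points and so lies in a finite interval. Growing
  intervals reach its dimension in steps of at most one and thus attain the smaller ones.\<close>

lemma interval_dim_exists:
  assumes "j \<le> m"
  obtains l where "dim (x ` {N..l}) = Suc j"
proof -
  obtain B where B: "B \<subseteq> x ` {N..}" "independent B" "card B = dim (x ` {N..})"
    using basis_exists by metis
  then have "finite B" by (simp add: finiteI_independent)
  then obtain I where I: "I \<subseteq> {N..}" "finite I" "B = x ` I"
    using B(1) finite_subset_image by metis
  define b where "b = Max (insert N I)"
  have b: "N \<le> b" "I \<subseteq> {N..b}" using I by (auto simp: b_def)
  have "card B \<le> dim (x ` {N..b})"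
    using B(2) I(3) b(2) by (metis dim_eq_card_independent dim_subset image_mono)
  then have jb: "j < dim (x ` {N..b})" using assms tail_dim[of N] B(3) by simp
  have ins: "x ` {N..Suc i} = insert (x (Suc i)) (x ` {N..i})" if "N \<le> i" for i
    using that by (simp add: atLeastAtMostSuc_conv)
  show ?thesis
  \<comment> \<open>A single point already has dimension 1, so the crossing argument starts at
    \<open>j \<ge> 1\<close>.\<close>
  proof (cases "j = 0")
    case True
    have "dim (x ` {N..N}) = Suc j" using x_nonzero by (simp add: True dim_insert)
    then show ?thesis by (rule that)
  next
    case False
    let ?F = "\<lambda>i. dim (x ` {N..N + i})"
    have "?F (Suc i) \<le> Suc (?F i)" for i by (simp add: ins dim_insert)
    moreover have "?F 0 \<le> j" using False by simp
    moreover have "j < ?F (b - N)" using jb b by simp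
    ultimately show ?thesis
      using nat_step_crossing[of ?F 0 j "b - N"] that by auto
  qed
qed

text \<open>
  The bound at the left end comes from adjoining the next point, the one at the right end from
  adjoining the previous point. In both cases the bound at the opposite end in dimension \<open>j + 1\<close>
  limits how much is lost; the smaller of the two resulting bases then satisfies both bounds.
\<close>

lemma interval_volume_bound:
  assumes "slope j \<ge> 0" and "slope m < 0"
  shows "\<exists>C. \<forall>f l. dim (x ` {f..l}) = Suc j \<longrightarrow>
    (\<exists>xs. int_basis xs (span (x ` {f..l})) \<and>
       ln (gvol xs) \<le> \<theta> ^ j * slope j * h f + C \<and> ln (gvol xs) \<le> slope j * h l + C)"
  using assms(1)
proof (induction j)
  case 0
  have "\<exists>xs. int_basis xs (span (x ` {f..l})) \<and>
      ln (gvol xs) \<le> h f + c \<and> ln (gvol xs) \<le> h l + c" if d: "dim (x ` {f..l}) = 1" for f l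
  proof (intro exI conjI)
    have fl: "f \<le> l" using d by (cases "f \<le> l") auto
    have "span {x f} = span (x ` {f..l})"
      using d fl x_nonzero by (intro subspace_dim_equal span_mono) (auto simp: dim_insert)
    then show ib: "int_basis [x f] (span (x ` {f..l}))"
      using x_nonzero x_Ints by (simp add: int_basis_def)
    have "ln (gvol [x f]) \<le> ln (exp (h f + c))"
      using gvol_pos[OF ib] norm_x[of f] by (intro ln_mono) auto
    then show "ln (gvol [x f]) \<le> h f + c" by simp
    also have "\<dots> \<le> h l + c" using mono_h fl by (simp add: monoD)
    finally show "ln (gvol [x f]) \<le> h l + c" .
  qed
  then show ?case by auto
next
  case (Suc j)
  \<comment> \<open>\<open>a\<close> and \<open>b\<close> are the exponents at the left and the
    right end in dimension \<open>j + 1\<close>. Inserting \<open>growth\<close> into the forward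
    bound leaves \<open>- g * h p\<close> up to constants.\<close>
  define a where "a = \<theta> ^ j * slope j"
  define b where "b = slope j"
  define g where "g = 1 - \<theta> * (1 - \<alpha>)"
  have \<theta>j: "\<theta> ^ j > 0" using \<theta>_gt_1 by simp
  have aj: "\<alpha> / \<theta> ^ j > 0" using \<alpha>_pos \<theta>j by simp
  have b_pos: "b > 0" using Suc.prems aj by (simp add: slope_Suc b_def)
  have a_pos: "a > 0" using b_pos \<theta>j by (simp add: a_def b_def)
  have \<alpha>_le: "\<alpha> \<le> a"
    using Suc.prems \<theta>j by (simp add: slope_Suc a_def field_simps)
  \<comment> \<open>This is where \<open>slope m < 0\<close> enters: by \<open>slope_defect\<close>
    at \<open>m\<close>, the sum of a negative term and \<open>g\<close> is positive.\<close>
  have g_pos: "g > 0"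
  proof -
    have "\<theta> ^ m * ((\<theta> - 1) * slope m + g) > 0"
      unfolding g_def slope_defect using \<alpha>_pos \<theta>_gt_1 by simp
    then have "(\<theta> - 1) * slope m + g > 0" using \<theta>_gt_1 by (simp add: zero_less_mult_iff)
    moreover have "(\<theta> - 1) * slope m < 0" using assms(2) \<theta>_gt_1 by (simp add: mult_less_0_iff)
    ultimately show ?thesis by linarith
  qed
  \<comment> \<open>Eliminating \<open>\<alpha> * \<theta>\<close> with \<open>slope_defect\<close>
    turns the left exponent of the next dimension into \<open>a * (1 - g / b)\<close>, the form that
    the forward estimate produces.\<close>
  have next_a: "\<theta> ^ Suc j * slope (Suc j) = \<theta> ^ j * (b - g)"
  proof -
    have "\<theta> ^ j * ((\<theta> - 1) * b + g) = \<alpha> * \<theta>"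
      unfolding g_def b_def by (rule slope_defect)
    moreover have "\<theta> ^ Suc j * slope (Suc j) = \<theta> ^ j * \<theta> * b - \<theta> * \<alpha>"
      using \<theta>_gt_1 by (simp add: slope_Suc b_def field_simps)
    ultimately show ?thesis by (simp add: algebra_simps)
  qed
  have g_le: "g \<le> b"
  proof -
    have "0 \<le> \<theta> ^ j * (b - g)" unfolding next_a[symmetric] using Suc.prems \<theta>_gt_1 by simp
    then show ?thesis using \<theta>j by (simp add: zero_le_mult_iff)
  qed
  have \<alpha>_le_1: "\<alpha> \<le> 1"
    using Suc.prems slope_antimono[of 1 "Suc j"] by (simp add: slope_def)
  obtain C where C: "\<And>f l. dim (x ` {f..l}) = Suc j \<Longrightarrow>
      \<exists>xs. int_basis xs (span (x ` {f..l})) \<and>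
        ln (gvol xs) \<le> a * h f + C \<and> ln (gvol xs) \<le> b * h l + C"
    using Suc.IH b_pos unfolding a_def b_def by (metis less_imp_le)
  define C1 where "C1 = C * (1 - g / b) + g * C / b + (1 - \<alpha>) * c + c"
  define C2 where "C2 = C * (1 - \<alpha> / a) + \<alpha> * C / a + c"
  have "\<exists>xs. int_basis xs (span (x ` {f..l})) \<and>
       ln (gvol xs) \<le> \<theta> ^ Suc j * slope (Suc j) * h f + max C1 C2 \<and>
       ln (gvol xs) \<le> slope (Suc j) * h l + max C1 C2"
    if d: "dim (x ` {f..l}) = Suc (Suc j)" for f l
  proof -
    obtain xs where xs: "int_basis xs (span (x ` {f..l}))"
      "ln (gvol xs) \<le> \<theta> ^ Suc j * slope (Suc j) * h f + C1"
    proof -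
      obtain p where p: "f \<le> p" "dim (x ` {f..p}) = Suc j" "x (Suc p) \<notin> span (x ` {f..p})"
        "span (insert (x (Suc p)) (x ` {f..p})) = span (x ` {f..l})"
        using dim_interval_split_last[OF d] .
      obtain xs where xs: "int_basis xs (span (x ` {f..p}))"
        "ln (gvol xs) \<le> a * h f + C" "ln (gvol xs) \<le> b * h p + C"
        using C[OF p(2)] by blast
      obtain r where r: "norm (x (Suc p) - r *\<^sub>R x p) \<le> exp ((1 - \<alpha>) * h (Suc p) - h p + c)"
        using forward by blast
      have "x p \<in> span (x ` {f..p})" using p(1) by (intro span_base) auto
      from int_basis_extend[OF xs(1) p(3) x_Ints this r]
      have ys: "int_basis (x (Suc p) # xs) (span (x ` {f..l}))"
        "ln (gvol (x (Suc p) # xs)) \<le> ln (gvol xs) + ((1 - \<alpha>) * h (Suc p) - h p + c)"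
        unfolding p(4) by auto
      have "(1 - \<alpha>) * h (Suc p) \<le> (1 - \<alpha>) * (\<theta> * h p + c)"
        using \<alpha>_le_1 growth by (intro mult_left_mono) auto
      then have "ln (gvol (x (Suc p) # xs)) \<le> ln (gvol xs) - g * h p + (1 - \<alpha>) * c + c"
        using ys(2) by (simp add: g_def algebra_simps)
      \<comment> \<open>The right-end bound for \<open>xs\<close> is read as a lower bound for
        \<open>h p\<close>. A small \<open>h p\<close> would make the gain \<open>g * h p\<close>
        small, but then the volume of \<open>xs\<close> is small as well.\<close>
      also have "\<dots> \<le> ln (gvol xs) - g * ((ln (gvol xs) - C) / b) + (1 - \<alpha>) * c + c"
        using mult_left_mono[of "(ln (gvol xs) - C) / b" "h p" g] xs(3) b_pos g_pos
        by (simp add: pos_divide_le_eq mult.commute)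
      also have "\<dots> = ln (gvol xs) * (1 - g / b) + g * C / b + (1 - \<alpha>) * c + c"
        using b_pos by (simp add: field_simps)
      \<comment> \<open>The coefficient \<open>1 - g / b\<close> is nonnegative by
        \<open>g_le\<close>, so the left-end bound can be inserted.\<close>
      also have "\<dots> \<le> (a * h f + C) * (1 - g / b) + g * C / b + (1 - \<alpha>) * c + c"
        using xs(2) g_le b_pos by (intro add_right_mono mult_right_mono) auto
      also have "\<dots> = a * (1 - g / b) * h f + C1"
        by (simp add: C1_def algebra_simps)
      also have "a * (1 - g / b) = \<theta> ^ Suc j * slope (Suc j)"
        unfolding next_a using b_pos by (simp add: a_def b_def[symmetric] field_simps)
      finally show ?thesis using ys(1) that by blast
    qed
    moreover obtain ys where ys: "int_basis ys (span (x ` {f..l}))"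
      "ln (gvol ys) \<le> slope (Suc j) * h l + C2"
    proof -
      obtain p where p: "f \<le> p" "p < l" "dim (x ` {Suc p..l}) = Suc j"
        "x p \<notin> span (x ` {Suc p..l})"
        "span (insert (x p) (x ` {Suc p..l})) = span (x ` {f..l})"
        using dim_interval_split_first[OF d] .
      obtain xs where xs: "int_basis xs (span (x ` {Suc p..l}))"
        "ln (gvol xs) \<le> a * h (Suc p) + C" "ln (gvol xs) \<le> b * h l + C"
        using C[OF p(3)] by blast
      obtain r where r: "norm (x p - r *\<^sub>R x (Suc p)) \<le> exp (- \<alpha> * h (Suc p) + c)"
        using backward by blast
      have "x (Suc p) \<in> span (x ` {Suc p..l})" using p(2) by (intro span_base) auto
      from int_basis_extend[OF xs(1) p(4) x_Ints this r]
      have ys: "int_basis (x p # xs) (span (x ` {f..l}))"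
        "ln (gvol (x p # xs)) \<le> ln (gvol xs) + (- \<alpha> * h (Suc p) + c)"
        unfolding p(5) by auto
      note ys(2)
      \<comment> \<open>The same trade with the ends exchanged: the left-end bound for
        \<open>xs\<close> gives a lower bound for \<open>h (Suc p)\<close>.\<close>
      also have "ln (gvol xs) + (- \<alpha> * h (Suc p) + c)
          \<le> ln (gvol xs) - \<alpha> * ((ln (gvol xs) - C) / a) + c"
        using mult_left_mono[of "(ln (gvol xs) - C) / a" "h (Suc p)" \<alpha>] xs(2) a_pos \<alpha>_pos
        by (simp add: pos_divide_le_eq mult.commute)
      also have "\<dots> = ln (gvol xs) * (1 - \<alpha> / a) + \<alpha> * C / a + c"
        using a_pos by (simp add: field_simps)
      also have "\<dots> \<le> (b * h l + C) * (1 - \<alpha> / a) + \<alpha> * C / a + c"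
        using xs(3) \<alpha>_le a_pos by (intro add_right_mono mult_right_mono) auto
      also have "\<dots> = b * (1 - \<alpha> / a) * h l + C2"
        by (simp add: C2_def algebra_simps)
      also have "b * (1 - \<alpha> / a) = slope (Suc j)"
        using b_pos \<theta>j by (simp add: slope_Suc a_def b_def[symmetric] field_simps)
      finally show ?thesis using ys(1) that by blast
    qed
    ultimately show ?thesis
      by (cases "ln (gvol xs) \<le> ln (gvol ys)")
        (force intro!: exI[of _ xs], force intro!: exI[of _ ys])
  qed
  then show ?case by blast
qed

text \<open>Let \<open>j + 1\<close> be the first index with negative slope. Far out in the
  sequence, adjoining the previous point to an interval of dimension \<open>j + 1\<close> would give
  independent integer vectors of volume less than 1.\<close>

lemma exponent_inequality: "\<alpha> * (\<Sum>i<m. 1 / \<theta> ^ i) \<le> 1"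
proof (rule ccontr)
  assume "\<not> ?thesis"
  then have neg: "slope m < 0" by (simp add: slope_def)
  define k where "k = (LEAST k. slope k < 0)"
  have k: "slope k < 0" "k \<le> m" unfolding k_def
    using neg by (auto intro: LeastI Least_le)
  then obtain j where j: "k = Suc j" by (cases k) auto
  have "slope j \<ge> 0" using not_less_Least[of j "\<lambda>k. slope k < 0"] j k_def by force
  from interval_volume_bound[OF this neg] obtain C where C:
    "\<And>f l. dim (x ` {f..l}) = Suc j \<Longrightarrow> \<exists>xs. int_basis xs (span (x ` {f..l})) \<and>
       ln (gvol xs) \<le> \<theta> ^ j * slope j * h f + C" by blast
  \<comment> \<open>This equals \<open>- (\<theta> ^ j * slope (Suc j))\<close> and is therefore
    positive by the choice of \<open>k\<close>.\<close>
  define \<delta> where "\<delta> = \<alpha> - \<theta> ^ j * slope j"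
  have "\<delta> > 0"
    using k(1) \<theta>_gt_1 by (simp add: \<delta>_def j slope_Suc field_simps)
  have "\<forall>\<^sub>F i in sequentially. h i \<ge> (\<bar>C + c\<bar> + 1) / \<delta>"
    using h_at_top by (simp add: filterlim_at_top)
  then obtain N where N: "\<And>i. i \<ge> N \<Longrightarrow> h i \<ge> (\<bar>C + c\<bar> + 1) / \<delta>"
    by (auto simp: eventually_sequentially)
  obtain l where l: "dim (x ` {N..l}) = Suc (Suc j)"
    using interval_dim_exists[of "Suc j"] k(2) j by blast
  obtain p where p: "N \<le> p" "p < l" "dim (x ` {Suc p..l}) = Suc j" "x p \<notin> span (x ` {Suc p..l})"
    using dim_interval_split_first[OF l] by metis
  obtain xs where xs: "int_basis xs (span (x ` {Suc p..l}))"
    "ln (gvol xs) \<le> \<theta> ^ j * slope j * h (Suc p) + C"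
    using C[OF p(3)] by blast
  obtain r where r: "norm (x p - r *\<^sub>R x (Suc p)) \<le> exp (- \<alpha> * h (Suc p) + c)"
    using backward by blast
  have "x (Suc p) \<in> span (x ` {Suc p..l})" using p(2) by (intro span_base) auto
  from int_basis_extend[OF xs(1) p(4) x_Ints this r]
  obtain U where U: "int_basis (x p # xs) U"
    and "ln (gvol (x p # xs)) \<le> ln (gvol xs) + (- \<alpha> * h (Suc p) + c)" by blast
  then have "ln (gvol (x p # xs)) \<le> - \<delta> * h (Suc p) + (C + c)"
    using xs(2) by (simp add: \<delta>_def algebra_simps)
  moreover have "ln (gvol (x p # xs)) \<ge> 0" using gvol_ge_1[OF U] by simp
  moreover have "\<delta> * h (Suc p) \<ge> \<bar>C + c\<bar> + 1"
    using N[of "Suc p"] p(1) \<open>\<delta> > 0\<close> by (simp add: field_simps)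
  ultimately show False by linarith
qed

end

section \<open>Best approximations to a point of the subspace\<close>

lemma dist_int_nonneg: "0 \<le> dist_int x"
  by (simp add: dist_int_def)

lemma dist_int_le: "dist_int x \<le> \<bar>x - of_int z\<bar>"
  by (simp add: dist_int_def round_diff_minimal)

lemma dist_int_le_half: "dist_int x \<le> 1 / 2"
  using of_int_round_abs_le[of x] by (simp add: dist_int_def abs_minus_commute)

definition sim_err :: "'d \<Rightarrow> real ^ 'd \<Rightarrow> nat \<Rightarrow> real" where
  "sim_err k \<xi> q = (MAX j\<in>- {k}. dist_int (real q * \<xi> $ j))"

definition nearest_vec :: "real ^ 'd \<Rightarrow> nat \<Rightarrow> real ^ 'd" where
  "nearest_vec \<xi> q = (\<chi> j. of_int (round (real q * \<xi> $ j)))"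

lemma Compl_singleton_nonempty:
  fixes k :: "'d :: finite"
  assumes "CARD('d) \<ge> 2"
  shows "- {k} \<noteq> {}"
proof
  assume "- {k} = {}"
  then have "(UNIV :: 'd set) = {k}" by blast
  then have "CARD('d) = card {k}" by simp
  then show False using assms by simp
qed

lemma sim_err_bounds:
  fixes k :: "'d :: finite"
  assumes "CARD('d) \<ge> 2"
  shows "0 \<le> sim_err k \<xi> q" and "sim_err k \<xi> q \<le> 1 / 2"
proof -
  note ne = Compl_singleton_nonempty[OF assms, of k]
  then obtain j where j: "j \<in> - {k}" by blast
  show "sim_err k \<xi> q \<le> 1 / 2"
    unfolding sim_err_def 
    by (intro Max.boundedI) (simp, use ne in blast, use dist_int_le_half in blast)
  have "dist_int (real q * \<xi> $ j) \<le> sim_err k \<xi> q"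
    unfolding sim_err_def using j by (intro Max_ge) auto
  then show "0 \<le> sim_err k \<xi> q" using dist_int_nonneg order_trans by blast
qed

lemma nearest_vec_component:
  fixes k :: "'d :: finite"
  assumes "CARD('d) \<ge> 2" "\<xi> $ k = 1"
  shows "\<bar>nearest_vec \<xi> q $ j - real q * \<xi> $ j\<bar> \<le> sim_err k \<xi> q"
proof (cases "j = k")
  case True
  \<comment> \<open>The coordinate \<open>k\<close>, which \<open>sim_err\<close> omits, is the
    integer \<open>q\<close> and is rounded without error.\<close>
  have "round (real q) = int q" by (metis of_int_of_nat_eq round_of_int)
  then show ?thesis using assms True sim_err_bounds[OF assms(1)] by (simp add: nearest_vec_def)
next
  case False
  then have "dist_int (real q * \<xi> $ j) \<le> sim_err k \<xi> q"
    unfolding sim_err_def by (intro Max_ge) auto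
  then show ?thesis by (simp add: nearest_vec_def dist_int_def abs_minus_commute)
qed

lemma nearest_vec_norm:
  fixes k :: "'d :: finite"
  assumes "CARD('d) \<ge> 2" "\<xi> $ k = 1"
  shows "norm (nearest_vec \<xi> q - real q *\<^sub>R \<xi>) \<le> real CARD('d) * sim_err k \<xi> q"
proof -
  have "norm (nearest_vec \<xi> q - real q *\<^sub>R \<xi>)
      \<le> (\<Sum>j\<in>UNIV. \<bar>(nearest_vec \<xi> q - real q *\<^sub>R \<xi>) $ j\<bar>)"
    by (rule norm_le_l1_cart)
  also have "\<dots> \<le> (\<Sum>j\<in>(UNIV :: 'd set). sim_err k \<xi> q)"
    using nearest_vec_component[OF assms] by (intro sum_mono) simp
  finally show ?thesis by simp
qed

text \<open>Starting from 1, one passes repeatedly to the least denominator with a strictly smaller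
  value.\<close>

lemma record_sequence:
  fixes \<psi> :: "nat \<Rightarrow> real"
  assumes pos: "\<And>q. 0 < q \<Longrightarrow> 0 < \<psi> q" and small: "\<And>e. 0 < e \<Longrightarrow> \<exists>q>0. \<psi> q < e"
  obtains X :: "nat \<Rightarrow> nat" where "strict_mono X" "\<And>i. 0 < X i"
    "\<And>i. \<psi> (X (Suc i)) < \<psi> (X i)"
    "\<And>i q. 0 < q \<Longrightarrow> q < X (Suc i) \<Longrightarrow> \<psi> (X i) \<le> \<psi> q"
proof -
  define nxt where "nxt q = (LEAST p. 0 < p \<and> \<psi> p < \<psi> q)" for q
  have nxt: "0 < nxt q \<and> \<psi> (nxt q) < \<psi> q" if "0 < q" for q
    unfolding nxt_def using small[OF pos[OF that]]
    by (rule LeastI_ex[of "\<lambda>p. 0 < p \<and> \<psi> p < \<psi> q"])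
  have least: "\<psi> q \<le> \<psi> p" if "0 < p" "p < nxt q" for p q
    using that not_less_Least[of p "\<lambda>p. 0 < p \<and> \<psi> p < \<psi> q"] by (auto simp: nxt_def)
  define X where "X = rec_nat (1 :: nat) (\<lambda>_. nxt)"
  have X0: "X 0 = 1" and XS: "X (Suc i) = nxt (X i)" for i by (simp_all add: X_def)
  have Xpos: "0 < X i" for i
  proof (induction i)
    case (Suc i) then show ?case using nxt unfolding XS by blast
  qed (simp add: X0)
  have dec: "\<psi> (X (Suc i)) < \<psi> (X i)" for i using nxt[OF Xpos] by (simp add: XS)
  have "X i < X (Suc i)" for i
  proof (cases i)
    case 0
    then show ?thesis using dec[of 0] Xpos[of 1] by (cases "X 1 = 1") (auto simp: X0)
  next
    case (Suc j)
    \<comment> \<open>\<open>X i\<close> is the least denominator with value below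
      \<open>\<psi> (X j)\<close>, and the value at \<open>X (Suc i)\<close> is smaller
      still.\<close>
    show ?thesis
    proof (rule ccontr)
      assume "\<not> X i < X (Suc i)"
      then consider "X (Suc i) = X i" | "X (Suc i) < nxt (X j)" using Suc XS by force
      then show False
        using dec[of i] dec[of j] least[of "X (Suc i)" "X j"] Xpos Suc by cases auto
    qed
  qed
  then have "strict_mono X" by (simp add: strict_mono_Suc_iff)
  then show ?thesis using that Xpos dec least XS by metis
qed

text \<open>Otherwise a basis chosen from \<open>S\<close>, enlarged by unit vectors, spans a
  rational subspace of exactly the complementary dimension that contains the nonzero vector
  \<open>\<xi>\<close> of \<open>L\<close>.\<close>

lemma completely_irrational_dim:
  fixes L :: "(real ^ 'd) set"
  assumes "completely_irrational L" "\<xi> \<in> L" "\<xi> \<noteq> 0" "\<xi> \<in> span S"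
    and Z: "\<And>v i. v \<in> S \<Longrightarrow> v $ i \<in> \<int>"
  shows "CARD('d) - dim L < dim S"
proof (rule ccontr)
  assume "\<not> ?thesis"
  then have le: "dim S \<le> CARD('d) - dim L" by simp
  obtain B where B: "B \<subseteq> S" "independent B" "S \<subseteq> span B" "card B = dim S"
    using basis_exists by metis
  have "B \<subseteq> B \<union> range (\<lambda>i. axis i 1)" by simp
  then obtain B' where B': "B \<subseteq> B'" "B' \<subseteq> B \<union> range (\<lambda>i. axis i 1)" "independent B'"
    "B \<union> range (\<lambda>i. axis i 1) \<subseteq> span B'"
    using maximal_independent_subset_extend[OF _ B(2)] by metis
  have "Basis \<subseteq> span B'" using B'(4) by (auto simp: Basis_vec_def)
  then have "span B' = UNIV" by (metis span_Basis span_mono span_span top.extremum_uniqueI)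
  then have "card B' = CARD('d)"
    using dim_eq_card_independent[OF B'(3)] dim_span[of B'] by (simp add: dim_UNIV)
  moreover have "finite B'" using B'(3) by (simp add: finiteI_independent)
  ultimately obtain B'' where B'': "B \<subseteq> B''" "B'' \<subseteq> B'" "card B'' = CARD('d) - dim L"
    using exists_subset_between[of B "CARD('d) - dim L" B'] le B B' by auto
  have ind: "independent B''" using B'(3) B''(2) independent_mono by blast
  have "v $ i \<in> \<int>" if "v \<in> B''" for v i
  proof -
    from that consider "v \<in> S" | j where "v = axis j 1" using B''(2) B'(2) B(1) by blast
    then show ?thesis by cases (auto simp: Z axis_def)
  qed
  then have "rational_subspace (span B'')" unfolding rational_subspace_def using ind by blast
  moreover have "dim (span B'') = CARD('d) - dim L"
    using B''(3) ind by (simp add: dim_eq_card_independent)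
  ultimately have "L \<inter> span B'' = {0}"
    using assms(1) unfolding completely_irrational_def by blast
  moreover have "\<xi> \<in> span B''"
    using assms(4) B(3) B''(1) by (meson span_minimal span_mono subsetD subspace_span order_trans)
  ultimately show False using assms(2,3) by blast
qed

text \<open>Round \<open>q * \<xi>\<close> to integers \<open>x\<close> with error \<open>e\<close>.
  On \<open>I\<close> they have size \<open>O(q)\<close>, and because \<open>\<xi>\<close> lies in
  \<open>L\<close> the linear forms at \<open>x\<close> are within \<open>O(e)\<close> of the
  integers \<open>x j\<close>. Bad approximability then bounds \<open>q ^ n * e ^ m\<close> from
  below.\<close>

lemma badly_approximable_sim_err_lower:
  fixes L :: "(real ^ 'd) set" and k :: 'd
  assumes "badly_approximable_subspace L" "1 \<le> dim L" "dim L < CARD('d)"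
    and "\<xi> \<in> L" "\<xi> $ k = 1"
  obtains c Q where "0 < c" "\<And>q. Q \<le> q \<Longrightarrow> 0 < q \<Longrightarrow>
    c * real q powr (- w_exp (dim L) CARD('d)) \<le> sim_err k \<xi> q"
proof -
  define n where "n = dim L"
  define m where "m = CARD('d) - n"
  have m: "0 < m" using assms(3) by (simp add: m_def n_def)
  have card2: "CARD('d) \<ge> 2" using assms by simp
  obtain I \<Theta> where I: "card I = n" and bad: "badly_approximable_matrix (- I) I \<Theta>"
    and L: "L = {v. \<forall>j\<in>- I. v $ j = (\<Sum>i\<in>I. \<Theta> j i * v $ i)}"
    using assms(1) unfolding badly_approximable_subspace_def n_def by blast
  have cardJ: "card (- I) = m" by (simp add: Compl_eq_Diff_UNIV card_Diff_subset I m_def)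
  have ne: "I \<noteq> {}" "- I \<noteq> {}"
    using I cardJ assms(2) m unfolding n_def by (metis card.empty not_one_le_zero less_irrefl)+
  obtain c0 where c0: "0 < c0" and bad': "\<And>x :: 'd \<Rightarrow> int. (\<exists>i\<in>I. x i \<noteq> 0) \<Longrightarrow>
      c0 < (MAX i\<in>I. \<bar>real_of_int (x i)\<bar>) ^ n *
        (MAX j\<in>- I. dist_int (\<Sum>i\<in>I. \<Theta> j i * real_of_int (x i))) ^ m"
    using bad unfolding badly_approximable_matrix_def I cardJ by blast
  have "\<exists>i\<in>I. \<xi> $ i \<noteq> 0"
  proof (rule ccontr)
    assume 0: "\<not> ?thesis"
    then have "\<xi> $ j = 0" for j using assms(4) L by (cases "j \<in> I") auto
    then show False using assms(5) by simp
  qed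
  then obtain i0 where i0: "i0 \<in> I" "\<xi> $ i0 \<noteq> 0" by blast
  \<comment> \<open>From \<open>Q\<close> on, \<open>q * \<xi> $ i0\<close> has absolute value at
    least 1, so its rounding is nonzero.\<close>
  obtain Q where Q: "1 / \<bar>\<xi> $ i0\<bar> \<le> real Q" using real_arch_simple by blast
  define K where "K = 1 + (\<Sum>j\<in>UNIV. \<bar>\<xi> $ j\<bar>)"
  define T where "T = 1 + (\<Sum>j\<in>UNIV. \<Sum>i\<in>I. \<bar>\<Theta> j i\<bar>)"
  have "K \<ge> 1" "T \<ge> 1" by (auto simp: K_def T_def intro!: sum_nonneg)
  \<comment> \<open>Chosen so that \<open>(q * K) ^ n * (T * e) ^ m\<close> equals \<open>c0\<close>
    at \<open>e = c * q powr (- n / m)\<close>.\<close>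
  define c where "c = (c0 / (K ^ n * T ^ m)) powr (1 / real m)"
  have cpos: "c > 0" using c0 \<open>K \<ge> 1\<close> \<open>T \<ge> 1\<close> by (simp add: c_def)
  have "c * real q powr (- w_exp n CARD('d)) \<le> sim_err k \<xi> q" if q: "Q \<le> q" "0 < q" for q
  proof (rule ccontr)
    assume "\<not> ?thesis"
    then have lt: "sim_err k \<xi> q < c * real q powr (- w_exp n CARD('d))" by simp
    define e where "e = sim_err k \<xi> q"
    have e: "0 \<le> e" "e \<le> 1 / 2" using sim_err_bounds[OF card2] by (auto simp: e_def)
    define x where "x i = round (real q * \<xi> $ i)" for i
    have x: "\<bar>real_of_int (x i) - real q * \<xi> $ i\<bar> \<le> e" for i
      using nearest_vec_component[OF card2 assms(5), where q = q and j = i]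
      by (simp add: e_def x_def nearest_vec_def)
    have "x i0 \<noteq> 0"
    proof
      assume "x i0 = 0"
      then have "real q * \<bar>\<xi> $ i0\<bar> \<le> 1 / 2" using x[of i0] e by (simp add: abs_mult)
      moreover have "1 \<le> real Q * \<bar>\<xi> $ i0\<bar>" using Q i0 by (simp add: field_simps)
      moreover have "real Q * \<bar>\<xi> $ i0\<bar> \<le> real q * \<bar>\<xi> $ i0\<bar>"
        using q by (intro mult_right_mono) auto
      ultimately show False by linarith
    qed
    then have "c0 < (MAX i\<in>I. \<bar>real_of_int (x i)\<bar>) ^ n *
        (MAX j\<in>- I. dist_int (\<Sum>i\<in>I. \<Theta> j i * real_of_int (x i))) ^ m"
      using i0 by (intro bad') blast
    also have "\<dots> \<le> (real q * K) ^ n * (T * e) ^ m"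
    proof (intro mult_mono power_mono)
      show "(MAX i\<in>I. \<bar>real_of_int (x i)\<bar>) \<le> real q * K"
      proof (intro Max.boundedI)
        fix a assume "a \<in> (\<lambda>i. \<bar>real_of_int (x i)\<bar>) ` I"
        then obtain i where i: "a = \<bar>real_of_int (x i)\<bar>" by blast
        have "\<bar>\<xi> $ i\<bar> \<le> (\<Sum>j\<in>UNIV. \<bar>\<xi> $ j\<bar>)" by (intro member_le_sum) auto
        then have "real q * (1 + \<bar>\<xi> $ i\<bar>) \<le> real q * K"
          unfolding K_def by (intro mult_left_mono) auto
        moreover have "a \<le> real q * \<bar>\<xi> $ i\<bar> + 1"
          using x[of i] e abs_triangle_ineq2[of "real_of_int (x i)" "real q * \<xi> $ i"]
          by (simp add: i abs_mult)
        moreover have "1 \<le> real q" using q by simp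
        ultimately show "a \<le> real q * K" unfolding distrib_left by linarith
      qed (use ne in auto)
      show "(MAX j\<in>- I. dist_int (\<Sum>i\<in>I. \<Theta> j i * real_of_int (x i))) \<le> T * e"
      proof (intro Max.boundedI)
        fix a assume "a \<in> (\<lambda>j. dist_int (\<Sum>i\<in>I. \<Theta> j i * real_of_int (x i))) ` (- I)"
        then obtain j where j: "j \<in> - I" "a = dist_int (\<Sum>i\<in>I. \<Theta> j i * real_of_int (x i))"
          by blast
        have \<xi>j: "\<xi> $ j = (\<Sum>i\<in>I. \<Theta> j i * \<xi> $ i)" using assms(4) L j by auto
        have "a \<le> \<bar>(\<Sum>i\<in>I. \<Theta> j i * real_of_int (x i)) - real_of_int (x j)\<bar>"
          unfolding j(2) by (rule dist_int_le)
        \<comment> \<open>The terms containing \<open>q\<close> cancel by the equation of the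
          subspace for coordinate \<open>j\<close>.\<close>
        also have "(\<Sum>i\<in>I. \<Theta> j i * real_of_int (x i)) - real_of_int (x j)
            = (\<Sum>i\<in>I. \<Theta> j i * (real_of_int (x i) - real q * \<xi> $ i))
              - (real_of_int (x j) - real q * \<xi> $ j)"
          by (simp add: \<xi>j right_diff_distrib sum_subtractf sum_distrib_left mult.left_commute)
        also have "\<bar>\<dots>\<bar> \<le> (\<Sum>i\<in>I. \<bar>\<Theta> j i * (real_of_int (x i) - real q * \<xi> $ i)\<bar>)
            + \<bar>real_of_int (x j) - real q * \<xi> $ j\<bar>"
          by (intro order_trans[OF abs_triangle_ineq4] add_right_mono sum_abs)
        also have "\<dots> \<le> (\<Sum>i\<in>I. \<bar>\<Theta> j i\<bar> * e) + e"
          unfolding abs_mult using x by (intro add_mono sum_mono mult_left_mono) auto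
        also have "\<dots> = (1 + (\<Sum>i\<in>I. \<bar>\<Theta> j i\<bar>)) * e"
          by (simp add: sum_distrib_left algebra_simps)
        also have "\<dots> \<le> T * e"
          unfolding T_def using e
          by (intro mult_right_mono add_left_mono)
            (auto intro!: member_le_sum[where f = "\<lambda>j. \<Sum>i\<in>I. \<bar>\<Theta> j i\<bar>"] sum_nonneg)
        finally show "a \<le> T * e" .
      qed (use ne in auto)
      have "0 \<le> \<bar>real_of_int (x i0)\<bar>" by simp
      also have "\<dots> \<le> (MAX i\<in>I. \<bar>real_of_int (x i)\<bar>)" using i0 by (intro Max_ge) auto
      finally show "0 \<le> (MAX i\<in>I. \<bar>real_of_int (x i)\<bar>)" .
      obtain j0 where j0: "j0 \<in> - I" using ne by blast
      have "0 \<le> dist_int (\<Sum>i\<in>I. \<Theta> j0 i * real_of_int (x i))" by (rule dist_int_nonneg)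
      also have "\<dots> \<le> (MAX j\<in>- I. dist_int (\<Sum>i\<in>I. \<Theta> j i * real_of_int (x i)))"
        using j0 by (intro Max_ge) auto
      finally show "0 \<le> (MAX j\<in>- I. dist_int (\<Sum>i\<in>I. \<Theta> j i * real_of_int (x i)))" .
      then show "0 \<le> (MAX j\<in>- I. dist_int (\<Sum>i\<in>I. \<Theta> j i * real_of_int (x i))) ^ m" by simp
      show "0 \<le> (real q * K) ^ n" using \<open>K \<ge> 1\<close> by simp
    qed
    also have "\<dots> = real q ^ n * K ^ n * T ^ m * e ^ m"
      by (simp add: power_mult_distrib)
    also have "\<dots> \<le> real q ^ n * K ^ n * T ^ m * (c * real q powr (- w_exp n CARD('d))) ^ m"
      using lt e \<open>K \<ge> 1\<close> \<open>T \<ge> 1\<close> by (intro mult_left_mono power_mono) (auto simp: e_def)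
    also have "(c * real q powr (- w_exp n CARD('d))) ^ m = c0 / (K ^ n * T ^ m) / real q ^ n"
    proof -
      have "c ^ m = c0 / (K ^ n * T ^ m)"
        using m c0 \<open>K \<ge> 1\<close> \<open>T \<ge> 1\<close> by (simp add: c_def powr_powr flip: powr_realpow)
      moreover have "(real q powr (- w_exp n CARD('d))) ^ m = real q powr (- w_exp n CARD('d) * m)"
        using q by (simp add: powr_powr flip: powr_realpow)
      moreover have "w_exp n CARD('d) * real m = real n" using m by (simp add: w_exp_def m_def)
      ultimately show ?thesis
        using q by (simp add: power_mult_distrib power_divide powr_minus_divide powr_realpow)
    qed
    also have "real q ^ n * K ^ n * T ^ m * (c0 / (K ^ n * T ^ m) / real q ^ n) = c0"
      using q \<open>K \<ge> 1\<close> \<open>T \<ge> 1\<close> by simp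
    finally show False by simp
  qed
  then show ?thesis using that[of c Q] cpos n_def by blast
qed

section \<open>The bound for the uniform exponent\<close>

text \<open>The known zero \<open>w_exp n d\<close> is divided out by summing a geometric series.
  The last factor expresses equality in \<open>exponent_inequality\<close> with
  \<open>\<theta> = w_exp n d / x\<close>.\<close>

lemma W_poly_factor:
  assumes "1 \<le> n" "n < d"
  shows "W_poly n d x = w_exp n d ^ (d - n) * (x / w_exp n d - 1) *
    (x * (\<Sum>i<d - n. (x / w_exp n d) ^ i) - 1)"
proof -
  define w where "w = w_exp n d"
  obtain m where m: "d - n = Suc m" using assms by (metis Suc_diff_Suc)
  have "w > 0" using assms by (simp add: w_def w_exp_def)
  define r where "r = x / w"
  have x: "x = w * r" using \<open>w > 0\<close> by (simp add: r_def)
  define S where "S = (\<Sum>i<Suc m. r ^ i)"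
  have S: "r ^ Suc m - 1 = (r - 1) * S" unfolding S_def by (rule power_diff_1_eq)
  have "w ^ Suc m * (r - 1) * (x * S - 1) = w ^ Suc m * (x * (r ^ Suc m - 1) - (r - 1))"
    unfolding S by (simp add: algebra_simps)
  also have "\<dots> = x ^ (Suc m + 1) - w ^ (Suc m - 1) * (1 + w) * x + w ^ Suc m"
    by (simp add: x algebra_simps power_mult_distrib)
  finally show ?thesis by (simp only: W_poly_def m S_def r_def w_def)
qed

lemma W_exp_less:
  assumes "2 \<le> n" "n < d"
  shows "0 < W_exp n d" and "W_exp n d < w_exp n d"
    and "W_exp n d * (\<Sum>i<d - n. (W_exp n d / w_exp n d) ^ i) = 1"
proof -
  have W: "W_exp n d \<in> {0<..<w_exp n d} \<and> W_poly n d (W_exp n d) = 0"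
    using theI'[OF W_poly_unique_root[OF assms]] assms by (simp add: W_exp_def)
  then show "0 < W_exp n d" "W_exp n d < w_exp n d" by auto
  moreover from this have "W_exp n d / w_exp n d \<noteq> 1" "w_exp n d \<noteq> 0" by auto
  ultimately show "W_exp n d * (\<Sum>i<d - n. (W_exp n d / w_exp n d) ^ i) = 1"
    using W W_poly_factor[of n d "W_exp n d"] assms by simp
qed

text \<open>The expression increases strictly with \<open>\<alpha>\<close> and has the value 1 at
  \<open>W_exp n d\<close>.\<close>

lemma W_exp_sum_gt_1:
  assumes "2 \<le> n" "n < d" "W_exp n d < \<alpha>"
  shows "1 < \<alpha> * (\<Sum>i<d - n. (\<alpha> / w_exp n d) ^ i)"
proof -
  note W = W_exp_less[OF assms(1,2)]
  let ?S = "\<lambda>x. \<Sum>i<d - n. (x / w_exp n d) ^ i"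
  have S: "0 < ?S (W_exp n d)" using W by (metis zero_less_mult_pos zero_less_one)
  have "1 = W_exp n d * ?S (W_exp n d)" using W by simp
  also have "\<dots> < \<alpha> * ?S (W_exp n d)" using S assms by simp
  also have "\<dots> \<le> \<alpha> * ?S \<alpha>"
    using W assms by (intro mult_left_mono sum_mono power_mono divide_right_mono) auto
  finally show ?thesis .
qed

text \<open>The hypothesis is applied at half of the next record, so that its solution
  \<open>q\<close> lies strictly below that record; the factor \<open>2 powr \<gamma>\<close> pays
  for the halving.\<close>

lemma record_upper_bound:
  fixes \<psi> :: "nat \<Rightarrow> real" and X :: "nat \<Rightarrow> nat"
  assumes "strict_mono X"
    and rec: "\<And>i q. 0 < q \<Longrightarrow> q < X (Suc i) \<Longrightarrow> \<psi> (X i) \<le> \<psi> q"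
    and ev: "\<forall>\<^sub>F t :: real in at_top. \<exists>q>0. real q \<le> t \<and> \<psi> q \<le> t powr (- \<gamma>)"
  shows "\<forall>\<^sub>F i in sequentially. \<psi> (X i) \<le> 2 powr \<gamma> * real (X (Suc i)) powr (- \<gamma>)"
proof -
  have "filterlim (\<lambda>i. real (X (Suc i)) / 2) at_top sequentially"
  proof -
    have "filterlim X sequentially sequentially"
      by (rule filterlim_subseq[OF assms(1)])
    then have "filterlim (\<lambda>i. X (Suc i)) sequentially sequentially"
      by (simp add: filterlim_sequentially_Suc)
    then have "filterlim (\<lambda>i. real (X (Suc i))) at_top sequentially"
      by (rule filterlim_compose[OF filterlim_real_sequentially])
    then show ?thesis by (rule filterlim_at_top_mult_tendsto_pos[OF tendsto_const, of "1/2", simplified])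
  qed
  from eventually_compose_filterlim[OF ev this] show ?thesis
  proof eventually_elim
    case (elim i)
    then obtain q where q: "0 < q" "real q \<le> real (X (Suc i)) / 2"
      "\<psi> q \<le> (real (X (Suc i)) / 2) powr (- \<gamma>)" by blast
    have "\<psi> (X i) \<le> \<psi> q" using q by (intro rec) auto
    also note q(3)
    also have "(real (X (Suc i)) / 2) powr (- \<gamma>) = 2 powr \<gamma> * real (X (Suc i)) powr (- \<gamma>)"
      by (simp add: powr_divide powr_minus field_simps)
    finally show ?case .
  qed
qed

text \<open>Comparing the upper and lower bounds for the record errors gives the first claim. The
  second is \<open>exponent_inequality\<close> for the nearest integer vectors with
  \<open>\<theta> = w / \<gamma>\<close>, which exceeds 1 when \<open>\<gamma> < w\<close>.\<close>

lemma uniform_exponent_sum_bound: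
  fixes L :: "(real ^ 'd) set" and k :: 'd
  assumes "1 \<le> dim L" "dim L < CARD('d)"
    and bad: "badly_approximable_subspace L" and irr: "completely_irrational L"
    and \<xi>: "\<xi> \<in> L" "\<xi> $ k = 1"
    and \<gamma>: "0 < \<gamma>"
    and ev: "\<forall>\<^sub>F t :: real in at_top. \<exists>q>0. real q \<le> t \<and> sim_err k \<xi> q \<le> t powr (- \<gamma>)"
  shows "\<gamma> \<le> w_exp (dim L) CARD('d)"
    and "\<gamma> < w_exp (dim L) CARD('d) \<Longrightarrow>
      \<gamma> * (\<Sum>i<CARD('d) - dim L. (\<gamma> / w_exp (dim L) CARD('d)) ^ i) \<le> 1"
proof -
  define w where "w = w_exp (dim L) CARD('d)"
  define \<psi> where "\<psi> = sim_err k \<xi>"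
  define d where "d = real CARD('d)"
  have card2: "CARD('d) \<ge> 2" using assms by simp
  then have d: "d \<ge> 2" by (simp add: d_def)
  note bnd = sim_err_bounds[OF card2, of k \<xi>, folded \<psi>_def]
  obtain c0 Q where c0: "0 < c0" and low: "\<And>q. Q \<le> q \<Longrightarrow> 0 < q \<Longrightarrow> c0 * real q powr (- w) \<le> \<psi> q"
    using badly_approximable_sim_err_lower[OF bad assms(1,2) \<xi>] unfolding w_def \<psi>_def by metis
  have near: "norm (nearest_vec \<xi> q - real q *\<^sub>R \<xi>) \<le> d * \<psi> q" for q
    unfolding d_def \<psi>_def by (rule nearest_vec_norm[OF card2 \<xi>(2)])
  have pos: "0 < \<psi> q" if q: "0 < q" for q
  proof (rule ccontr)
    assume "\<not> 0 < \<psi> q"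
    then have z: "\<psi> q = 0" using bnd(1)[of q] by simp
    \<comment> \<open>If \<open>q * \<xi>\<close> is integral, so is this multiple, which is large
      enough to contradict the lower bound valid from \<open>Q\<close> on.\<close>
    define p where "p = Suc Q * q"
    have v: "real q *\<^sub>R \<xi> = nearest_vec \<xi> q" using near[of q] z by simp
    have "dist_int (real p * \<xi> $ j) = 0" for j
    proof -
      have "real q * \<xi> $ j = of_int (round (real q * \<xi> $ j))"
        using arg_cong[OF v, of "\<lambda>u. u $ j"] by (simp add: nearest_vec_def)
      then have "real p * \<xi> $ j = of_int (int (Suc Q) * round (real q * \<xi> $ j))"
        by (simp add: p_def algebra_simps)
      then show ?thesis
        using dist_int_le[of "real p * \<xi> $ j" "int (Suc Q) * round (real q * \<xi> $ j)"]
          dist_int_nonneg[of "real p * \<xi> $ j"] by simp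
    qed
    then have "\<psi> p = 0"
      using Compl_singleton_nonempty[OF card2, of k] by (simp add: \<psi>_def sim_err_def)
    moreover have "Suc Q * 1 \<le> p" unfolding p_def using q by (intro mult_le_mono2) simp
    then have "Q \<le> p" "0 < p" by simp_all
    ultimately have "c0 * real p powr (- w) \<le> 0" using low[of p] by simp
    moreover have "0 < c0 * real p powr (- w)" using c0 \<open>0 < p\<close> by simp
    ultimately show False by simp
  qed
  have small: "\<exists>q>0. \<psi> q < e" if "0 < e" for e
  proof -
    have "((\<lambda>t :: real. t powr (- \<gamma>)) \<longlongrightarrow> 0) at_top"
      using \<gamma> by (intro tendsto_neg_powr filterlim_ident) auto
    then have "\<forall>\<^sub>F t :: real in at_top. t powr (- \<gamma>) < e"
      using that by (simp add: order_tendsto_iff)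
    with ev have "\<forall>\<^sub>F t :: real in at_top. \<exists>q>0. \<psi> q < e"
      unfolding \<psi>_def by eventually_elim force
    then show ?thesis by (simp add: eventually_const)
  qed

  \<comment> \<open>Record denominators and bounds for their errors\<close>
  obtain X where X: "strict_mono X" "\<And>i. 0 < X i" "\<And>i. \<psi> (X (Suc i)) < \<psi> (X i)"
    "\<And>i q. 0 < q \<Longrightarrow> q < X (Suc i) \<Longrightarrow> \<psi> (X i) \<le> \<psi> q"
    using record_sequence[of \<psi>, OF pos small] by metis
  have X_lim: "filterlim (\<lambda>i. real (X i)) at_top sequentially"
    by (rule filterlim_compose[OF filterlim_real_sequentially filterlim_subseq[OF X(1)]])
  define h where "h i = ln (real (X i))" for i
  have h_lim: "filterlim h at_top sequentially"
    unfolding h_def by (rule filterlim_compose[OF ln_at_top X_lim])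
  have exp_h: "exp (h i) = real (X i)" for i using X(2)[of i] by (simp add: h_def)
  define A where "A = \<gamma> * ln 2"
  have "\<forall>\<^sub>F i in sequentially. ln (\<psi> (X i)) \<le> A - \<gamma> * h (Suc i)"
  proof (rule eventually_mono)
    show "\<forall>\<^sub>F i in sequentially. \<psi> (X i) \<le> 2 powr \<gamma> * real (X (Suc i)) powr (- \<gamma>)"
      using X(1,4) ev by (intro record_upper_bound) (auto simp: \<psi>_def)
  next
    fix i assume "\<psi> (X i) \<le> 2 powr \<gamma> * real (X (Suc i)) powr (- \<gamma>)"
    then have "ln (\<psi> (X i)) \<le> ln (2 powr \<gamma> * real (X (Suc i)) powr (- \<gamma>))"
      using pos[OF X(2)] by (intro ln_mono) auto
    also have "\<dots> = A - \<gamma> * h (Suc i)"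
      using X(2)[of "Suc i"] by (simp add: ln_mult ln_powr A_def h_def)
    finally show "ln (\<psi> (X i)) \<le> A - \<gamma> * h (Suc i)" .
  qed
  moreover have "\<forall>\<^sub>F i in sequentially. ln c0 - w * h i \<le> ln (\<psi> (X i))"
  proof -
    have "\<forall>\<^sub>F i in sequentially. Q \<le> X i"
      using filterlim_subseq[OF X(1)] by (simp add: filterlim_at_top)
    then show ?thesis
    proof eventually_elim
      case (elim i)
      have "ln c0 - w * h i = ln (c0 * real (X i) powr (- w))"
        using c0 X(2)[of i] by (simp add: ln_mult ln_powr h_def)
      also have "\<dots> \<le> ln (\<psi> (X i))"
        using low[OF elim X(2)] c0 X(2)[of i] by (intro ln_mono) auto
      finally show ?case .
    qed
  qed
  ultimately have "\<forall>\<^sub>F i in sequentially. ln (\<psi> (X i)) \<le> A - \<gamma> * h (Suc i) \<and>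
      ln c0 - w * h i \<le> ln (\<psi> (X i))" by (rule eventually_conj)
  then obtain N where N: "\<And>i. N \<le> i \<Longrightarrow> ln (\<psi> (X i)) \<le> A - \<gamma> * h (Suc i)"
    "\<And>i. N \<le> i \<Longrightarrow> ln c0 - w * h i \<le> ln (\<psi> (X i))"
    by (auto simp: eventually_sequentially)
  have h_mono: "mono h"
    using X(1,2) by (auto simp: h_def mono_def strict_mono_less_eq intro!: ln_mono)

  \<comment> \<open>Otherwise the two bounds for the same record keep
    \<open>(\<gamma> - w) * h i\<close> bounded although \<open>h\<close> tends to infinity.\<close>
  show le: "\<gamma> \<le> w"
  proof (rule ccontr)
    assume "\<not> \<gamma> \<le> w"
    then have gw: "0 < \<gamma> - w" by simp
    have "\<forall>\<^sub>F i in sequentially. h i > (A - ln c0) / (\<gamma> - w)"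
      using h_lim by (simp add: filterlim_at_top_dense)
    moreover have "\<forall>\<^sub>F i in sequentially. N \<le> i" by (rule eventually_ge_at_top)
    ultimately have "\<forall>\<^sub>F i in sequentially. False"
    proof eventually_elim
      case (elim i)
      have "\<gamma> * h i \<le> \<gamma> * h (Suc i)" using h_mono \<gamma> by (simp add: monoD)
      then have "(\<gamma> - w) * h i \<le> A - ln c0" using N[OF elim(2)] by (simp add: algebra_simps)
      then show ?case using elim(1) gw by (simp add: field_simps)
    qed
    then show False by simp
  qed

  \<comment> \<open>The chain of nearest integer vectors\<close>
  assume lt: "\<gamma> < w"
  \<comment> \<open>The shift by \<open>N\<close> makes both error bounds valid from the first
    index.\<close>
  define x where "x i = nearest_vec \<xi> (X (N + i))" for i
  define H where "H i = h (N + i)" for i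
  define \<theta> where "\<theta> = w / \<gamma>"
  \<comment> \<open>The summands serve, in this order, the size of the points, the forward and
    backward errors, and the growth.\<close>
  define c where "c = \<bar>ln (norm \<xi> + d)\<bar> + \<bar>A + ln (2 * d)\<bar> + \<bar>(A - ln c0) / \<gamma>\<bar>"
  have c_ge: "ln (norm \<xi> + d) \<le> c" "A + ln (2 * d) \<le> c" "(A - ln c0) / \<gamma> \<le> c"
    unfolding c_def by linarith+
  have err: "exp (ln (\<psi> (X (N + i)))) = \<psi> (X (N + i))" for i using pos X(2) by simp
  have up: "ln (\<psi> (X (N + i))) \<le> A - \<gamma> * H (Suc i)" for i using N(1)[of "N + i"] by (simp add: H_def)
  have near_x: "norm (x i - real (X (N + i)) *\<^sub>R \<xi>) \<le> d * \<psi> (X (N + i))" for i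
    unfolding x_def by (rule near)
  \<comment> \<open>Eliminates \<open>\<xi>\<close> between approximations to two of its multiples;
    below, \<open>r\<close> is the ratio of neighbouring records.\<close>
  have pair: "norm (u - r *\<^sub>R v) \<le> d * (a + r * b)"
    if "norm (u - (r * t) *\<^sub>R \<xi>) \<le> d * a" "norm (v - t *\<^sub>R \<xi>) \<le> d * b" "0 \<le> r" for u v r t a b
  proof -
    have "u - r *\<^sub>R v = (u - (r * t) *\<^sub>R \<xi>) - r *\<^sub>R (v - t *\<^sub>R \<xi>)"
      by (simp add: algebra_simps)
    then have "norm (u - r *\<^sub>R v) \<le> norm (u - (r * t) *\<^sub>R \<xi>) + norm (r *\<^sub>R (v - t *\<^sub>R \<xi>))"
      by (metis norm_triangle_ineq4)
    also have "\<dots> \<le> d * a + r * (d * b)" using that by (intro add_mono) (auto intro: mult_left_mono)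
    finally show ?thesis by (simp add: algebra_simps)
  qed
  interpret approximation_chain x H \<gamma> \<theta> c "CARD('d) - dim L"
  proof
    fix i
    let ?a = "real (X (N + i))" and ?b = "real (X (N + Suc i))"
    let ?e = "\<psi> (X (N + i))" and ?e' = "\<psi> (X (N + Suc i))"
    have ab: "0 < ?a" "?a \<le> ?b" "1 \<le> ?a" using X(1) X(2)[of "N + i"] by (auto simp: strict_mono_less_eq)
    have ee: "?e' \<le> ?e" "0 < ?e" using X(3)[of "N + i"] pos X(2) by auto
    show "x i $ j \<in> \<int>" for j by (simp add: x_def nearest_vec_def)
    have "x i $ k = ?a"
      using \<xi>(2) round_of_int[of "int (X (N + i))"] by (simp add: x_def nearest_vec_def)
    then show "x i \<noteq> 0" using ab by auto
    have "norm (x i) \<le> norm (?a *\<^sub>R \<xi>) + norm (x i - ?a *\<^sub>R \<xi>)"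
      by (metis norm_triangle_sub)
    also have "\<dots> \<le> ?a * norm \<xi> + d * 1"
      using near_x[of i] bnd(2)[of "X (N + i)"] d
      by (intro add_mono order_trans[OF near_x[of i]] mult_left_mono) auto
    also have "\<dots> \<le> ?a * norm \<xi> + d * ?a"
      using ab d by (intro add_left_mono mult_left_mono) auto
    also have "\<dots> = ?a * (norm \<xi> + d)" by (simp add: algebra_simps)
    also have "\<dots> = exp (H i + ln (norm \<xi> + d))"
      using d unfolding exp_add H_def exp_h by (subst exp_ln) (auto intro: add_nonneg_pos)
    also have "\<dots> \<le> exp (H i + c)" using c_ge by simp
    finally show "norm (x i) \<le> exp (H i + c)" .
    have "norm (x (Suc i) - (?b / ?a) *\<^sub>R x i) \<le> d * (?e' + ?b / ?a * ?e)"
      using near_x[of "Suc i"] near_x[of i] ab by (intro pair[where t = ?a]) auto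
    also have "\<dots> \<le> d * (?b / ?a * ?e + ?b / ?a * ?e)"
    proof (intro mult_left_mono add_right_mono)
      have "1 * ?e \<le> ?b / ?a * ?e" using ab ee by (intro mult_right_mono) auto
      then show "?e' \<le> ?b / ?a * ?e" using ee by linarith
    qed (use d in auto)
    also have "\<dots> = exp (ln (2 * d) + H (Suc i) - H i + ln ?e)"
      using d by (simp add: exp_add exp_diff exp_h H_def err)
    also have "\<dots> \<le> exp ((1 - \<gamma>) * H (Suc i) - H i + c)"
      using up[of i] c_ge by (simp add: algebra_simps)
    finally show "\<exists>r. norm (x (Suc i) - r *\<^sub>R x i) \<le> exp ((1 - \<gamma>) * H (Suc i) - H i + c)" by blast
    have "norm (x i - (?a / ?b) *\<^sub>R x (Suc i)) \<le> d * (?e + ?a / ?b * ?e')"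
      using near_x[of "Suc i"] near_x[of i] ab by (intro pair[where t = ?b]) auto
    also have "\<dots> \<le> d * (?e + 1 * ?e)"
      using ab ee d pos[OF X(2), of "N + Suc i"] by (intro mult_left_mono add_left_mono mult_mono) auto
    also have "\<dots> = exp (ln (2 * d) + ln ?e)"
      using d by (simp add: exp_add err)
    also have "\<dots> \<le> exp (- \<gamma> * H (Suc i) + c)"
      using up[of i] c_ge by simp
    finally show "\<exists>r. norm (x i - r *\<^sub>R x (Suc i)) \<le> exp (- \<gamma> * H (Suc i) + c)" by blast
    have "\<gamma> * H (Suc i) \<le> w * H i + (A - ln c0)"
      using up[of i] N(2)[of "N + i"] by (simp add: H_def)
    then have "H (Suc i) \<le> (w * H i + (A - ln c0)) / \<gamma>"
      using \<gamma> by (simp add: pos_le_divide_eq mult.commute)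
    also have "\<dots> = \<theta> * H i + (A - ln c0) / \<gamma>" by (simp add: \<theta>_def add_divide_distrib)
    also have "\<dots> \<le> \<theta> * H i + c" using c_ge by simp
    finally show "H (Suc i) \<le> \<theta> * H i + c" .
  next
    show "mono H" using h_mono by (simp add: H_def mono_def)
    show "filterlim H at_top sequentially"
      unfolding H_def using filterlim_compose[OF h_lim filterlim_add_const_nat_at_top, of N]
      by (simp add: add.commute)
    show "0 < \<gamma>" by (rule \<gamma>)
    show "1 < \<theta>" using lt \<gamma> by (simp add: \<theta>_def)
    fix M
    \<comment> \<open>The rescaled points converge to \<open>\<xi>\<close> and subspaces are closed,
      so each tail spans a space containing \<open>\<xi>\<close>, to which complete irrationality
      applies.\<close>
    have "\<xi> \<in> span (x ` {M..})"
    proof (rule Lim_in_closed_set)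
      show "closed (span (x ` {M..}))" by (intro closed_subspace subspace_span)
      show "\<forall>\<^sub>F i in sequentially. (1 / real (X (N + i))) *\<^sub>R x i \<in> span (x ` {M..})"
        using eventually_ge_at_top[of M] by eventually_elim (auto intro: span_scale span_base)
      have "(\<lambda>i. d / real (X (N + i))) \<longlonglongrightarrow> 0"
        using filterlim_compose[OF X_lim filterlim_add_const_nat_at_top, of N]
        by (intro tendsto_divide_0[OF tendsto_const] filterlim_at_top_imp_at_infinity)
          (simp add: add.commute)
      moreover have "norm ((1 / real (X (N + i))) *\<^sub>R x i - \<xi>) \<le> d / real (X (N + i))" for i
      proof -
        let ?a = "real (X (N + i))"
        have a: "?a > 0" using X(2) by simp
        have "(1 / ?a) *\<^sub>R x i - \<xi> = (1 / ?a) *\<^sub>R (x i - ?a *\<^sub>R \<xi>)"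
          using a by (simp add: scaleR_diff_right)
        then have "norm ((1 / ?a) *\<^sub>R x i - \<xi>) = norm (x i - ?a *\<^sub>R \<xi>) / ?a" using a by simp
        also have "\<dots> \<le> d * 1 / ?a"
          using a bnd(2)[of "X (N + i)"] d
          by (intro divide_right_mono order_trans[OF near_x[of i]] mult_left_mono) auto
        finally show ?thesis by simp
      qed
      ultimately have "(\<lambda>i. (1 / real (X (N + i))) *\<^sub>R x i - \<xi>) \<longlonglongrightarrow> 0"
        by (rule Lim_null_comparison[OF always_eventually, rotated, OF _ allI])
      then show "(\<lambda>i. (1 / real (X (N + i))) *\<^sub>R x i) \<longlonglongrightarrow> \<xi>" by (simp add: LIM_zero_iff)
    qed simp
    then show "CARD('d) - dim L < dim (x ` {M..})"
      using \<xi> by (intro completely_irrational_dim[OF irr \<xi>(1)])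
        (auto simp: x_def nearest_vec_def)
  qed
  show "\<gamma> * (\<Sum>i<CARD('d) - dim L. (\<gamma> / w) ^ i) \<le> 1"
    using exponent_inequality by (simp add: \<theta>_def power_divide)
qed

theorem theorem3p4:
  fixes L :: "(real ^ 'd) set" and n :: nat and k :: 'd and \<xi> :: "real ^ 'd"
  assumes "CARD('d) \<ge> 3" and "1 \<le> n" and "n < CARD('d)"
    and "subspace L" and "dim L = n"
    and "badly_approximable_subspace L"
    and "completely_irrational L"
    and "\<xi> \<in> L" and "\<xi> $ k = 1"
  shows "uniform_exponent k \<xi> \<le> ereal (W_exp n CARD('d))"
proof -
  have "\<gamma> \<le> W_exp n CARD('d)" if \<gamma>: "0 < \<gamma>"
    and ev: "\<forall>\<^sub>F t :: real in at_top. \<exists>q :: int. 0 < q \<and> real_of_int q \<le> t \<and>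
      (MAX j\<in>- {k}. dist_int (real_of_int q * \<xi> $ j)) \<le> t powr (- \<gamma>)" for \<gamma>
  proof (rule ccontr)
    assume "\<not> \<gamma> \<le> W_exp n CARD('d)"
    then have gt: "W_exp n CARD('d) < \<gamma>" by simp
    have ev': "\<forall>\<^sub>F t :: real in at_top. \<exists>q>0. real q \<le> t \<and> sim_err k \<xi> q \<le> t powr (- \<gamma>)"
      using ev
    proof eventually_elim
      case (elim t)
      then obtain q :: int where "0 < q" "real_of_int q \<le> t"
        "(MAX j\<in>- {k}. dist_int (real_of_int q * \<xi> $ j)) \<le> t powr (- \<gamma>)" by blast
      then show ?case
        by (intro exI[of _ "nat q"]) (simp add: sim_err_def)
    qed
    note * = uniform_exponent_sum_bound[OF _ _ assms(6-9), unfolded assms(5), OF assms(2,3)]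
    have "\<gamma> \<le> w_exp n CARD('d)" using *(1)[OF \<gamma> ev'] .
    \<comment> \<open>For \<open>n = 1\<close> the bound is \<open>w_exp\<close> itself, and the
      first estimate already gives the contradiction.\<close>
    with gt have "n \<noteq> 1" by (auto simp: W_exp_def)
    then have n: "2 \<le> n" using assms(2) by simp
    note W = W_exp_less[OF n assms(3)]
    \<comment> \<open>The sum estimate requires an exponent strictly below \<open>w_exp\<close>,
      while \<open>\<gamma>\<close> may equal it. Lowering the exponent keeps the system solvable,
      since \<open>t powr (- \<gamma>) \<le> t powr (- \<alpha>)\<close> for
      \<open>t \<ge> 1\<close>.\<close>
    obtain \<alpha> where \<alpha>: "W_exp n CARD('d) < \<alpha>" "\<alpha> < min \<gamma> (w_exp n CARD('d))"
      using dense[of "W_exp n CARD('d)" "min \<gamma> (w_exp n CARD('d))"] gt W by auto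
    have "\<forall>\<^sub>F t :: real in at_top. \<exists>q>0. real q \<le> t \<and> sim_err k \<xi> q \<le> t powr (- \<alpha>)"
      using ev' eventually_ge_at_top[of 1]
    proof eventually_elim
      case (elim t)
      then have "t powr (- \<gamma>) \<le> t powr (- \<alpha>)" using \<alpha> by (intro powr_mono) auto
      then show ?case using elim(1) by force
    qed
    then have "\<alpha> * (\<Sum>i<CARD('d) - n. (\<alpha> / w_exp n CARD('d)) ^ i) \<le> 1"
      using \<alpha> W by (intro *(2)) auto
    then show False using W_exp_sum_gt_1[OF n assms(3) \<alpha>(1)] by simp
  qed
  then show ?thesis
    unfolding uniform_exponent_def by (intro Sup_least) auto
qed

end
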